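(* There exist asymptotically flat spacelike hypersurfaces in the Minkowski spacetime $\mathbb R^{3,1}$ with zero ADM energy-momentum ($E=0$ and $P=0$), but whose ADM angular momentum is finite and non-zero (i.e. $J(Y)$ exists and is finite for every rotation field $Y=\frac{\partial}{\partial x^i}\times\vec x$, $i=1,2,3$, and is non-zero for at least one of them).
   Context: Minkowski spacetime is $\mathbb R^{3,1}$ with metric $-dt^2+\sum_i(dx^i)^2$. A spacelike slice is written as a graph $t=f(x^1,x^2,x^3)$, and $(x^1,x^2,x^3)$ restricted to the graph is used as the asymptotically flat coordinate system. The hypersurface carries the induced metric $g$ and second fundamental form $k$ (for a graph, $g_{ij}=\delta_{ij}-f_if_j$, $k_{ij}=\frac{1}{\sqrt{1-|\bar\nabla f|^2}}\bar\nabla_i\bar\nabla_jf$ with $\bar\nabla$ the flat connection), and $\pi=k-(\mathrm{tr}_gk)g$. Asymptotically flat means: for some $q>\frac12$, $p>\frac32$, $\epsilon>0$, outside a compact set each end is diffeomorphic to the complement of a compact set in $\mathbb R^3$ with $g_{ij}-\delta_{ij}=O_2(r^{-q})$, $k_{ij}=O_1(r^{-p})$, and $\mu,|J|=O(r^{-3-\epsilon})$, where $\mu=\frac12(R_g-|k|_g^2+(\mathrm{tr}_gk)^2)$, $J=\mathrm{div}_g k-d(\mathrm{tr}_gk)$ (here both vanish). $O_l(r^a)$ means that derivatives of order $s\le l$ are $O(r^{a-s})$. ADM quantities (limits as $r\to\infty$ of integrals over $|x|=r$ with Euclidean area measure $d\sigma_0$): $E=\frac1{16\pi}\lim\int\sum_{j,k}(\partial_kg_{jk}-\partial_jg_{kk})\frac{x^j}{|x|}d\sigma_0$,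 $P_i=\frac1{8\pi}\lim\int\sum_k\pi_{ik}\frac{x^k}{|x|}d\sigma_0$, and $J(Y)=\frac1{8\pi}\lim\int\sum_{j,k}\pi_{jk}Y^j\frac{x^k}{|x|}d\sigma_0$. *)

theory Defs
  imports "HOL-Analysis.Analysis" "HOL-Library.Landau_Symbols"
begin

unbundle no cross3_syntax

definition pd :: "3 \<Rightarrow> (real^3 \<Rightarrow> 'b::real_normed_vector) \<Rightarrow> real^3 \<Rightarrow> 'b" where
  "pd i h x = frechet_derivative h (at x) (axis i 1)"

definition iter_pd :: "3 list \<Rightarrow> (real^3 \<Rightarrow> 'b::real_normed_vector) \<Rightarrow> real^3 \<Rightarrow> 'b" where
  "iter_pd is h = foldr pd is h"

text \<open>Differentiability of all iterated partial derivatives is equivalent to being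
  infinitely often continuously differentiable.\<close>

definition smooth :: "(real^3 \<Rightarrow> 'b::real_normed_vector) \<Rightarrow> bool" where
  "smooth h \<longleftrightarrow> (\<forall>is x. iter_pd is h differentiable (at x))"

text \<open>The class \<open>O\<^sub>l(r\<^sup>a)\<close>: near infinity the function has partial derivatives up to order
  \<open>l\<close> (in the Frechet sense, so that \<^const>\<open>pd\<close> is meaningful), and those of order
  \<open>s \<le> l\<close> are \<open>O(r\<^bsup>a-s\<^esup>)\<close>.\<close>

definition bigo_derivs :: "nat \<Rightarrow> real \<Rightarrow> (real^3 \<Rightarrow> real) \<Rightarrow> bool" where
  "bigo_derivs l a h \<longleftrightarrow>
     (\<forall>is. length is < l \<longrightarrow> (\<forall>\<^sub>F x in at_infinity. iter_pd is h differentiable (at x))) \<and>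
     (\<forall>is. length is \<le> l \<longrightarrow>
        iter_pd is h \<in> O[at_infinity](\<lambda>x. norm x powr (a - real (length is))))"

text \<open>Points of Minkowski spacetime are pairs \<open>(x, t)\<close>.\<close>

definition minkowski :: "(real^3) \<times> real \<Rightarrow> (real^3) \<times> real \<Rightarrow> real" where
  "minkowski u v = fst u \<bullet> fst v - snd u * snd v"

definition graph_map :: "(real^3 \<Rightarrow> real) \<Rightarrow> real^3 \<Rightarrow> (real^3) \<times> real" where
  "graph_map f x = (x, f x)"

definition grad :: "(real^3 \<Rightarrow> real) \<Rightarrow> real^3 \<Rightarrow> real^3" where
  "grad f x = (\<chi> i. pd i f x)"

definition induced_metric :: "(real^3 \<Rightarrow> real) \<Rightarrow> real^3 \<Rightarrow> real^3^3" where
  "induced_metric f x = (\<chi> i j. minkowski (pd i (graph_map f) x) (pd j (graph_map f) x))"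

definition spacelike_graph :: "(real^3 \<Rightarrow> real) \<Rightarrow> bool" where
  "spacelike_graph f \<longleftrightarrow> (\<forall>x v. v \<noteq> 0 \<longrightarrow> v \<bullet> (induced_metric f x *v v) > 0)"

text \<open>The future-directed unit normal \<open>N\<close>. The second fundamental form is
  \<open>k(u,v) = \<langle>D\<^sub>u N, v\<rangle> = - \<langle>N, D\<^sub>u v\<rangle>\<close>, where \<open>D\<close> is the flat connection of Minkowski
  spacetime; this sign makes \<open>k\<close> a positive multiple of the Hessian of \<open>f\<close>.\<close>

definition unit_normal :: "(real^3 \<Rightarrow> real) \<Rightarrow> real^3 \<Rightarrow> (real^3) \<times> real" where
  "unit_normal f x = (1 / sqrt (1 - (norm (grad f x))\<^sup>2)) *\<^sub>R (grad f x, 1)"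

definition second_form :: "(real^3 \<Rightarrow> real) \<Rightarrow> real^3 \<Rightarrow> real^3^3" where
  "second_form f x =
     (\<chi> i j. - minkowski (unit_normal f x) (pd i (pd j (graph_map f)) x))"

lemma smooth_differentiable: "smooth f \<Longrightarrow> f differentiable (at x)"
  unfolding smooth_def iter_pd_def by (drule spec[of _ "[]"]) simp

lemma smooth_pd_differentiable: "smooth f \<Longrightarrow> pd i f differentiable (at x)"
  unfolding smooth_def iter_pd_def
  by (drule spec[of _ "[i]"]) simp

lemma pd_graph_map:
  assumes "f differentiable (at x)"
  shows "pd i (graph_map f) x = (axis i 1, pd i f x)"
proof -
  have "(graph_map f has_derivative (\<lambda>v. (v, frechet_derivative f (at x) v))) (at x)"
    unfolding graph_map_def
    using assms frechet_derivative_works by (intro has_derivative_Pair has_derivative_ident) blast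
  then show ?thesis
    unfolding pd_def by (metis frechet_derivative_at)
qed

lemma pd_pd_graph_map:
  assumes "smooth f"
  shows "pd i (pd j (graph_map f)) x = (0, pd i (pd j f) x)"
proof -
  have eq: "pd j (graph_map f) = (\<lambda>x. (axis j 1, pd j f x))"
    using pd_graph_map smooth_differentiable[OF assms] by blast
  have "(pd j (graph_map f) has_derivative
      (\<lambda>v. (0, frechet_derivative (pd j f) (at x) v))) (at x)"
    unfolding eq
    using smooth_pd_differentiable[OF assms] frechet_derivative_works
    by (intro has_derivative_Pair has_derivative_const) blast
  then show ?thesis
    unfolding pd_def[of i] by (metis frechet_derivative_at)
qed

lemma induced_metric_graph:
  assumes "smooth f"
  shows "induced_metric f x $ i $ j = (mat 1 :: real^3^3) $ i $ j - pd i f x * pd j f x"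
  using pd_graph_map[OF smooth_differentiable[OF assms]]
  by (auto simp: induced_metric_def minkowski_def mat_def inner_axis_axis)

lemma second_form_graph:
  assumes "smooth f"
  shows "second_form f x $ i $ j = pd i (pd j f) x / sqrt (1 - (norm (grad f x))\<^sup>2)"
  by (simp add: second_form_def minkowski_def unit_normal_def pd_pd_graph_map[OF assms])

lemma spacelike_graph_iff:
  assumes "smooth f"
  shows "spacelike_graph f \<longleftrightarrow> (\<forall>x. norm (grad f x) < 1)"
proof -
  have q: "v \<bullet> (induced_metric f x *v v) = (norm v)\<^sup>2 - (grad f x \<bullet> v)\<^sup>2" for x v
    unfolding norm_eq_sqrt_inner
    by (simp add: inner_vec_def matrix_vector_mult_def sum_3 grad_def
        induced_metric_graph[OF assms] mat_def power2_eq_square algebra_simps)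
  show ?thesis
  proof
    assume L: "spacelike_graph f"
    show "\<forall>x. norm (grad f x) < 1"
    proof
      fix x
      show "norm (grad f x) < 1"
      proof (cases "grad f x = 0")
        case False
        then have "(norm (grad f x))\<^sup>2 - (grad f x \<bullet> grad f x)\<^sup>2 > 0"
          using L q unfolding spacelike_graph_def by metis
        then have "(norm (grad f x))\<^sup>2 * (1 - (norm (grad f x))\<^sup>2) > 0"
          by (simp add: power2_norm_eq_inner[symmetric] power2_eq_square right_diff_distrib)
        then have "(norm (grad f x))\<^sup>2 < 1"
          by (simp add: zero_less_mult_iff)
        then show ?thesis by (simp add: abs_square_less_1)
      qed simp
    qed
  next
    assume R: "\<forall>x. norm (grad f x) < 1"
    show "spacelike_graph f"
      unfolding spacelike_graph_def q
    proof (intro allI impI)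
      fix x and v :: "real^3" assume "v \<noteq> 0"
      have "\<bar>grad f x \<bullet> v\<bar> \<le> norm (grad f x) * norm v" by (rule Cauchy_Schwarz_ineq2)
      also have "\<dots> < norm v" using R \<open>v \<noteq> 0\<close> by simp
      finally have "(grad f x \<bullet> v)\<^sup>2 < (norm v)\<^sup>2"
        using abs_le_square_iff[of "norm v" "grad f x \<bullet> v"] by (simp flip: not_le)
      then show "(norm v)\<^sup>2 - (grad f x \<bullet> v)\<^sup>2 > 0" by simp
    qed
  qed
qed

lemma unit_normal_unit:
  assumes "norm (grad f x) < 1"
  shows "minkowski (unit_normal f x) (unit_normal f x) = -1"
proof -
  have p: "1 - (norm (grad f x))\<^sup>2 > 0" using assms by (simp add: abs_square_less_1)
  have "minkowski (unit_normal f x) (unit_normal f x)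
      = ((norm (grad f x))\<^sup>2 - 1) / (sqrt (1 - (norm (grad f x))\<^sup>2))\<^sup>2"
    by (simp add: minkowski_def unit_normal_def power2_norm_eq_inner diff_divide_distrib
        power_divide flip: power2_eq_square)
  also have "\<dots> = -1" using p by (simp add: divide_eq_eq)
  finally show ?thesis .
qed

lemma unit_normal_orthogonal:
  assumes "smooth f"
  shows "minkowski (unit_normal f x) (pd i (graph_map f) x) = 0"
  by (simp add: minkowski_def unit_normal_def inner_axis grad_def
      pd_graph_map[OF smooth_differentiable[OF assms]])

text \<open>A metric and a symmetric 2-tensor are given by their coordinate matrices.\<close>

definition christoffel :: "(real^3 \<Rightarrow> real^3^3) \<Rightarrow> 3 \<Rightarrow> 3 \<Rightarrow> 3 \<Rightarrow> real^3 \<Rightarrow> real" where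
  "christoffel g l i j x =
     (\<Sum>m\<in>UNIV. matrix_inv (g x) $ l $ m *
        (pd i (\<lambda>y. g y $ j $ m) x + pd j (\<lambda>y. g y $ i $ m) x - pd m (\<lambda>y. g y $ i $ j) x)) / 2"

definition ricci :: "(real^3 \<Rightarrow> real^3^3) \<Rightarrow> 3 \<Rightarrow> 3 \<Rightarrow> real^3 \<Rightarrow> real" where
  "ricci g i j x =
     (\<Sum>l\<in>UNIV. pd l (christoffel g l i j) x - pd j (christoffel g l i l) x) +
     (\<Sum>l\<in>UNIV. \<Sum>m\<in>UNIV. christoffel g l l m x * christoffel g m i j x
                       - christoffel g l j m x * christoffel g m i l x)"

definition scalar_curvature :: "(real^3 \<Rightarrow> real^3^3) \<Rightarrow> real^3 \<Rightarrow> real" where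
  "scalar_curvature g x = (\<Sum>i\<in>UNIV. \<Sum>j\<in>UNIV. matrix_inv (g x) $ i $ j * ricci g i j x)"

definition metric_trace :: "(real^3 \<Rightarrow> real^3^3) \<Rightarrow> (real^3 \<Rightarrow> real^3^3) \<Rightarrow> real^3 \<Rightarrow> real" where
  "metric_trace g k x = (\<Sum>i\<in>UNIV. \<Sum>j\<in>UNIV. matrix_inv (g x) $ i $ j * k x $ i $ j)"

definition tensor_norm_sq :: "(real^3 \<Rightarrow> real^3^3) \<Rightarrow> (real^3 \<Rightarrow> real^3^3) \<Rightarrow> real^3 \<Rightarrow> real" where
  "tensor_norm_sq g k x =
     (\<Sum>i\<in>UNIV. \<Sum>j\<in>UNIV. \<Sum>a\<in>UNIV. \<Sum>b\<in>UNIV.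
        matrix_inv (g x) $ i $ a * matrix_inv (g x) $ j $ b * k x $ i $ j * k x $ a $ b)"

definition covector_norm :: "(real^3 \<Rightarrow> real^3^3) \<Rightarrow> (3 \<Rightarrow> real^3 \<Rightarrow> real) \<Rightarrow> real^3 \<Rightarrow> real" where
  "covector_norm g w x =
     sqrt (\<Sum>i\<in>UNIV. \<Sum>j\<in>UNIV. matrix_inv (g x) $ i $ j * w i x * w j x)"

text \<open>The component \<open>(\<nabla>\<^sub>a k)\<^sub>i\<^sub>j\<close>.\<close>

definition cov_deriv ::
  "(real^3 \<Rightarrow> real^3^3) \<Rightarrow> (real^3 \<Rightarrow> real^3^3) \<Rightarrow> 3 \<Rightarrow> 3 \<Rightarrow> 3 \<Rightarrow> real^3 \<Rightarrow> real" where
  "cov_deriv g k a i j x = pd a (\<lambda>y. k y $ i $ j) x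
     - (\<Sum>m\<in>UNIV. christoffel g m a i x * k x $ m $ j + christoffel g m a j x * k x $ i $ m)"

definition divergence ::
  "(real^3 \<Rightarrow> real^3^3) \<Rightarrow> (real^3 \<Rightarrow> real^3^3) \<Rightarrow> 3 \<Rightarrow> real^3 \<Rightarrow> real" where
  "divergence g k j x =
     (\<Sum>a\<in>UNIV. \<Sum>i\<in>UNIV. matrix_inv (g x) $ a $ i * cov_deriv g k a i j x)"

definition energy_density :: "(real^3 \<Rightarrow> real^3^3) \<Rightarrow> (real^3 \<Rightarrow> real^3^3) \<Rightarrow> real^3 \<Rightarrow> real" where
  "energy_density g k x =
     (scalar_curvature g x - tensor_norm_sq g k x + (metric_trace g k x)\<^sup>2) / 2"

definition momentum_density ::
  "(real^3 \<Rightarrow> real^3^3) \<Rightarrow> (real^3 \<Rightarrow> real^3^3) \<Rightarrow> 3 \<Rightarrow> real^3 \<Rightarrow> real" where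
  "momentum_density g k j x = divergence g k j x - pd j (metric_trace g k) x"

definition conjugate_momentum ::
  "(real^3 \<Rightarrow> real^3^3) \<Rightarrow> (real^3 \<Rightarrow> real^3^3) \<Rightarrow> real^3 \<Rightarrow> real^3^3" where
  "conjugate_momentum g k x = k x - metric_trace g k x *\<^sub>R g x"

text \<open>Asymptotic flatness of data with a single end, in the chart \<open>x\<close>.\<close>

definition asymptotically_flat :: "(real^3 \<Rightarrow> real^3^3) \<Rightarrow> (real^3 \<Rightarrow> real^3^3) \<Rightarrow> bool" where
  "asymptotically_flat g k \<longleftrightarrow>
     (\<exists>q p \<epsilon>. q > 1/2 \<and> p > 3/2 \<and> \<epsilon> > 0 \<and>
        (\<forall>i j. bigo_derivs 2 (- q) (\<lambda>x. g x $ i $ j - (mat 1 :: real^3^3) $ i $ j)) \<and>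
        (\<forall>i j. bigo_derivs 1 (- p) (\<lambda>x. k x $ i $ j)) \<and>
        energy_density g k \<in> O[at_infinity](\<lambda>x. norm x powr (- 3 - \<epsilon>)) \<and>
        covector_norm g (momentum_density g k) \<in> O[at_infinity](\<lambda>x. norm x powr (- 3 - \<epsilon>)))"

definition spherical :: "real \<Rightarrow> real \<times> real \<Rightarrow> real^3" where
  "spherical r = (\<lambda>(\<theta>, \<phi>). vector [r * sin \<theta> * cos \<phi>, r * sin \<theta> * sin \<phi>, r * cos \<theta>])"

text \<open>The Euclidean area measure of the sphere \<open>|x| = r\<close> (for \<open>r > 0\<close>), as a measure on the
  ambient space: the image under spherical coordinates of the measure with density
  \<open>r\<^sup>2 sin \<theta> = |\<partial>\<^sub>\<theta> \<times> \<partial>\<^sub>\<phi>|\<close>, cf. the lemma \<open>spherical_area_element\<close>.\<close>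

definition sphere_area :: "real \<Rightarrow> (real^3) measure" where
  "sphere_area r =
     distr (density lborel
              (\<lambda>z. ennreal (r\<^sup>2 * sin (fst z)) * indicator ({0..pi} \<times> {0..2 * pi}) z))
           borel (spherical r)"

lemma norm_spherical: "r \<ge> 0 \<Longrightarrow> norm (spherical r (\<theta>, \<phi>)) = r"
proof -
  assume r: "r \<ge> 0"
  have "(r * sin \<theta> * cos \<phi>)\<^sup>2 + (r * sin \<theta> * sin \<phi>)\<^sup>2 + (r * cos \<theta>)\<^sup>2
      = r\<^sup>2 * ((sin \<theta>)\<^sup>2 * ((sin \<phi>)\<^sup>2 + (cos \<phi>)\<^sup>2) + (cos \<theta>)\<^sup>2)"
    by (simp only: power_mult_distrib algebra_simps)
  also have "\<dots> = r\<^sup>2" by simp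
  finally show ?thesis
    using r by (simp add: norm_vec_def L2_set_def sum_3 spherical_def)
qed

lemma spherical_area_element:
  assumes "0 \<le> \<theta>" "\<theta> \<le> pi"
  shows "((\<lambda>\<theta>. spherical r (\<theta>, \<phi>)) has_vector_derivative
            vector [r * cos \<theta> * cos \<phi>, r * cos \<theta> * sin \<phi>, - r * sin \<theta>]) (at \<theta>)" (is ?A)
    and "((\<lambda>\<phi>. spherical r (\<theta>, \<phi>)) has_vector_derivative
            vector [- r * sin \<theta> * sin \<phi>, r * sin \<theta> * cos \<phi>, 0]) (at \<phi>)" (is ?B)
    and "norm (cross3 (vector [r * cos \<theta> * cos \<phi>, r * cos \<theta> * sin \<phi>, - r * sin \<theta>])
            (vector [- r * sin \<theta> * sin \<phi>, r * sin \<theta> * cos \<phi>, 0])) = r\<^sup>2 * sin \<theta>" (is ?C)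
proof -
  have eq: "vector [a, b, c] = a *\<^sub>R axis 1 1 + b *\<^sub>R axis 2 1 + c *\<^sub>R (axis 3 1 :: real^3)"
    for a b c :: real
    by (simp add: vec_eq_iff forall_3 axis_def)
  show ?A
    unfolding spherical_def prod.case eq
    by (rule derivative_eq_intros refl | simp add: mult_ac)+
  show ?B
    unfolding spherical_def prod.case eq
    by (rule derivative_eq_intros refl | simp add: mult_ac)+
  have "(norm (cross3 (vector [r * cos \<theta> * cos \<phi>, r * cos \<theta> * sin \<phi>, - r * sin \<theta>])
            (vector [- r * sin \<theta> * sin \<phi>, r * sin \<theta> * cos \<phi>, 0])))\<^sup>2
      = (r\<^sup>2 * sin \<theta>)\<^sup>2 * ((cos \<theta>)\<^sup>2 * ((cos \<phi>)\<^sup>2 + (sin \<phi>)\<^sup>2)\<^sup>2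
          + (sin \<theta>)\<^sup>2 * ((cos \<phi>)\<^sup>2 + (sin \<phi>)\<^sup>2))"
    unfolding power2_norm_eq_inner
    by (simp add: cross3_def inner_vec_def sum_3 power2_eq_square algebra_simps
        del: sin_cos_squared_add sin_cos_squared_add2 sin_cos_squared_add3)
  also have "\<dots> = (r\<^sup>2 * sin \<theta>)\<^sup>2" by simp
  finally show ?C
    using assms sin_ge_zero by (auto simp: power2_eq_iff_nonneg)
qed

lemma spherical_measurable [measurable]: "spherical r \<in> borel_measurable borel"
proof -
  have "continuous_on UNIV (spherical r)"
    unfolding spherical_def case_prod_unfold
    by (subst continuous_on_componentwise)
       (auto simp: Basis_vec_def inner_axis forall_3 axis_eq_axis intro!: continuous_intros)
  then show ?thesis by (rule borel_measurable_continuous_onI)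
qed

lemma integral_sphere_area:
  fixes F :: "real^3 \<Rightarrow> real"
  assumes [measurable]: "F \<in> borel_measurable borel"
  shows "(LINT x|sphere_area r. F x)
       = (LINT z:{0..pi} \<times> {0..2 * pi}|lborel. r\<^sup>2 * sin (fst z) * F (spherical r z))"
proof -
  define A :: "(real \<times> real) set" where "A = {0..pi} \<times> {0..2 * pi}"
  have [measurable]: "A \<in> sets borel"
    unfolding A_def by (intro borel_closed closed_Times) auto
  define w where "w = (\<lambda>z. r\<^sup>2 * sin (fst z) * indicator A z :: real)"
  have [measurable]: "w \<in> borel_measurable borel"
    unfolding w_def
    by (intro borel_measurable_times borel_measurable_indicator borel_measurable_continuous_onI
        continuous_intros) auto
  have nn: "w z \<ge> 0" for z
    unfolding w_def A_def by (auto simp: indicator_def intro!: mult_nonneg_nonneg sin_ge_zero)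
  have w: "(\<lambda>z. ennreal (r\<^sup>2 * sin (fst z)) * indicator A z) = (\<lambda>z. ennreal (w z))"
    by (auto simp: w_def indicator_def)
  have "(LINT x|sphere_area r. F x) = (LINT z|density lborel (\<lambda>z. ennreal (w z)). F (spherical r z))"
    unfolding sphere_area_def A_def[symmetric] w by (rule integral_distr) measurable
  also have "\<dots> = (LINT z|lborel. w z *\<^sub>R F (spherical r z))"
    by (rule integral_density) (use nn in auto)
  also have "\<dots> = (LINT z:A|lborel. r\<^sup>2 * sin (fst z) * F (spherical r z))"
    unfolding set_lebesgue_integral_def w_def
    by (rule Bochner_Integration.integral_cong) (auto simp: mult_ac)
  finally show ?thesis unfolding A_def .
qed

text \<open>A predicate of the form \<open>has_\<dots>\<close> says that the defining limit exists and has the given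
  (finite) value.\<close>

definition has_ADM_energy :: "(real^3 \<Rightarrow> real^3^3) \<Rightarrow> real \<Rightarrow> bool" where
  "has_ADM_energy g E \<longleftrightarrow>
     ((\<lambda>r. 1 / (16 * pi) *
        (LINT x|sphere_area r. (\<Sum>j\<in>UNIV. \<Sum>k\<in>UNIV.
           (pd k (\<lambda>y. g y $ j $ k) x - pd j (\<lambda>y. g y $ k $ k) x) * (x $ j / norm x))))
      \<longlongrightarrow> E) at_top"

definition has_ADM_momentum ::
  "(real^3 \<Rightarrow> real^3^3) \<Rightarrow> (real^3 \<Rightarrow> real^3^3) \<Rightarrow> 3 \<Rightarrow> real \<Rightarrow> bool" where
  "has_ADM_momentum g k i P \<longleftrightarrow>
     ((\<lambda>r. 1 / (8 * pi) *
        (LINT x|sphere_area r. (\<Sum>l\<in>UNIV. conjugate_momentum g k x $ i $ l * (x $ l / norm x))))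
      \<longlongrightarrow> P) at_top"

definition has_ADM_angular_momentum ::
  "(real^3 \<Rightarrow> real^3^3) \<Rightarrow> (real^3 \<Rightarrow> real^3^3) \<Rightarrow> (real^3 \<Rightarrow> real^3) \<Rightarrow> real \<Rightarrow> bool" where
  "has_ADM_angular_momentum g k Y L \<longleftrightarrow>
     ((\<lambda>r. 1 / (8 * pi) *
        (LINT x|sphere_area r. (\<Sum>j\<in>UNIV. \<Sum>l\<in>UNIV.
           conjugate_momentum g k x $ j $ l * Y x $ j * (x $ l / norm x))))
      \<longlongrightarrow> L) at_top"

definition rotation_field :: "3 \<Rightarrow> real^3 \<Rightarrow> real^3" where
  "rotation_field i x = cross3 (axis i 1) x"

end

theory Submission
  imports Defs "HOL-Real_Asymp.Real_Asymp"
begin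

text \<open>For a graph of order \<open>r\<^bsup>1/3\<^esup>\<close>, the metric deviates from flat by \<open>r\<^bsup>-4/3\<^esup>\<close> and \<open>k\<close>
  is of order \<open>r\<^bsup>-5/3\<^esup>\<close>. The energy flux tends to 0, and \<open>\<mu>\<close> is of order \<open>r\<^bsup>-10/3\<^esup>\<close>,
  as is required of it, without any appeal to the Gauss equation. In the angular momentum the
  terms linear in \<open>f\<close> integrate to 0, the cubic ones are exactly of order 1, and the rest decays.
  If \<open>f\<close> behaves like \<open>r\<^bsup>1/3\<^esup> A\<close> for a function \<open>A\<close> on the unit sphere, then integration by parts
  turns the cubic part into \<open>-1/2 \<integral> |\<nabla>A|\<^sup>2 \<partial>\<^sub>\<phi>A\<close>, which is nonzero for \<open>A = x\<^sup>3y\<close>. The graph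
  \<open>f = \<epsilon> x\<^sup>3y (1 + r\<^sup>2)\<^bsup>-11/6\<^esup>\<close> is smooth, and spacelike for small \<open>\<epsilon>\<close>; the linear momentum
  vanishes because \<open>f\<close> is even, and two components of the angular momentum vanish because \<open>f\<close>
  is invariant under \<open>z \<mapsto> -z\<close>.\<close>

section \<open>Symbols\<close>

lemma pd_eqI: "(h has_derivative h') (at x) \<Longrightarrow> pd i h x = h' (axis i 1)"
  unfolding pd_def by (metis frechet_derivative_at)

lemma has_derivative_pd:
  "h differentiable (at x) \<Longrightarrow> (h has_derivative frechet_derivative h (at x)) (at x)"
  using frechet_derivative_works by blast

lemma pd_const [simp]: "pd i (\<lambda>_. c) = (\<lambda>_. 0)"
  by (rule ext, rule pd_eqI[of _ "\<lambda>_. 0", simplified]) simp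

lemma has_derivative_component: "((\<lambda>x::real^3. x $ j) has_derivative (\<lambda>v. v $ j)) (at x)"
  by (rule bounded_linear_imp_has_derivative) (rule bounded_linear_vec_nth)

lemma pd_coord [simp]: "pd i (\<lambda>x. x $ j) = (\<lambda>_. if i = j then 1 else 0)"
  by (rule ext) (simp add: pd_eqI[OF has_derivative_component] axis_def)

lemma pd_add:
  assumes "h differentiable (at x)" "k differentiable (at x)"
  shows "pd i (\<lambda>y. h y + k y) x = pd i h x + pd i k x"
  using pd_eqI[OF has_derivative_add[OF assms[THEN has_derivative_pd]]]
  by (simp add: pd_def)

lemma pd_mult:
  fixes h k :: "real^3 \<Rightarrow> real"
  assumes "h differentiable (at x)" "k differentiable (at x)"
  shows "pd i (\<lambda>y. h y * k y) x = h x * pd i k x + pd i h x * k x"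
  using pd_eqI[OF has_derivative_mult[OF assms[THEN has_derivative_pd]]]
  by (simp add: pd_def)

lemma has_derivative_powr_const:
  fixes h :: "real^3 \<Rightarrow> real"
  assumes "h differentiable (at x)" "h x > 0"
  shows "((\<lambda>y. h y powr s) has_derivative
    (\<lambda>v. s * h x powr (s - 1) * frechet_derivative h (at x) v)) (at x)"
proof -
  have "(\<lambda>v. h x powr s * (frechet_derivative h (at x) v * s) / h x)
      = (\<lambda>v. s * h x powr (s - 1) * frechet_derivative h (at x) v)"
    using assms(2) by (auto simp: powr_diff)
  with has_derivative_powr[OF has_derivative_pd[OF assms(1)] has_derivative_const[of s]] assms(2)
  show ?thesis by simp
qed

lemma pd_powr:
  fixes h :: "real^3 \<Rightarrow> real"
  assumes "h differentiable (at x)" "h x > 0"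
  shows "pd i (\<lambda>y. h y powr s) x = s * h x powr (s - 1) * pd i h x"
  using pd_eqI[OF has_derivative_powr_const[OF assms]] by (simp add: pd_def)

text \<open>A substitute for |x|^2 that never vanishes, so that its real powers are smooth at the
  origin too.\<close>

definition bracket :: "real^3 \<Rightarrow> real" where
  "bracket x = 1 + (norm x)\<^sup>2"

lemma bracket_ge_1 [simp]: "1 \<le> bracket x"
  and bracket_pos [simp]: "0 < bracket x"
  and bracket_nz [simp]: "bracket x \<noteq> 0"
  by (auto simp: bracket_def add_pos_nonneg add_nonneg_eq_0_iff)

text \<open>Functions of order \<open>d\<close> at infinity, together with all their derivatives; the bound is
  \<open>(1 + |x|\<^sup>2)\<^bsup>d/2\<^esup>\<close> so that it makes sense on all of space.\<close>

inductive symb :: "real \<Rightarrow> (real^3 \<Rightarrow> real) \<Rightarrow> bool" where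
  symb_zero: "symb d (\<lambda>_. 0)"
| symb_const: "symb 0 (\<lambda>_. c)"
| symb_coord: "symb 1 (\<lambda>x. x $ i)"
| symb_add: "symb d h \<Longrightarrow> symb d k \<Longrightarrow> symb d (\<lambda>x. h x + k x)"
| symb_mult: "symb a h \<Longrightarrow> symb b k \<Longrightarrow> symb (a + b) (\<lambda>x. h x * k x)"
| symb_mono: "symb a h \<Longrightarrow> a \<le> b \<Longrightarrow> symb b h"
| symb_powr: "symb a h \<Longrightarrow> 0 < c \<Longrightarrow> (\<And>x. c * bracket x powr (a / 2) \<le> h x)
    \<Longrightarrow> symb (a * s) (\<lambda>x. h x powr s)"

text \<open>The lower bound in the rule for real powers keeps the base positive, which makes the
  power differentiable everywhere.\<close>

lemma lower_bound_pos: "0 < c \<Longrightarrow> c * bracket x powr t \<le> y \<Longrightarrow> 0 < y"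
  by (rule less_le_trans[of _ "c * bracket x powr t"]) simp_all

lemma symb_differentiable: "symb d h \<Longrightarrow> h differentiable (at x)"
proof (induction rule: symb.induct)
  case (symb_coord i)
  then show ?case using has_derivative_component differentiableI by blast
next
  case (symb_powr a h c s)
  then have "h x > 0" using lower_bound_pos by blast
  then show ?case using has_derivative_powr_const[OF symb_powr.IH] differentiableI by blast
qed auto

lemma symb_continuous: "symb d h \<Longrightarrow> continuous_on UNIV h"
  by (meson symb_differentiable continuous_at_imp_continuous_on differentiable_imp_continuous_within)

text \<open>Each rule of \<open>symb\<close> preserves the estimate; for real powers, negative
  exponents turn the lower bound on the base into the upper bound on the power.\<close>

lemma symb_bound: "symb d h \<Longrightarrow> \<exists>C\<ge>0. \<forall>x. \<bar>h x\<bar> \<le> C * bracket x powr (d / 2)"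
proof (induction rule: symb.induct)
  case (symb_zero d)
  then show ?case by (auto intro: exI[of _ 0])
next
  case (symb_const c)
  then show ?case by (auto intro: exI[of _ "\<bar>c\<bar>"])
next
  case (symb_coord i)
  have "\<bar>x $ i\<bar> \<le> sqrt (bracket x)" for x :: "real^3"
    using component_le_norm_cart[of x i] real_le_rsqrt[of "norm x" "bracket x"]
    by (simp add: bracket_def)
  then show ?case by (auto simp: powr_half_sqrt less_imp_le intro!: exI[of _ 1])
next
  case (symb_add d h k)
  then obtain C C' where C: "C \<ge> 0" "C' \<ge> 0" "\<And>x. \<bar>h x\<bar> \<le> C * bracket x powr (d / 2)"
    "\<And>x. \<bar>k x\<bar> \<le> C' * bracket x powr (d / 2)" by metis
  have "\<bar>h x + k x\<bar> \<le> (C + C') * bracket x powr (d / 2)" for x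
    using C(3)[of x] C(4)[of x] by (simp add: distrib_right)
  then show ?case using C by (intro exI[of _ "C + C'"]) auto
next
  case (symb_mult a h b k)
  then obtain C C' where C: "C \<ge> 0" "C' \<ge> 0" "\<And>x. \<bar>h x\<bar> \<le> C * bracket x powr (a / 2)"
    "\<And>x. \<bar>k x\<bar> \<le> C' * bracket x powr (b / 2)" by metis
  have "\<bar>h x * k x\<bar> \<le> (C * C') * bracket x powr ((a + b) / 2)" for x
  proof -
    have "\<bar>h x * k x\<bar> \<le> (C * bracket x powr (a / 2)) * (C' * bracket x powr (b / 2))"
      unfolding abs_mult using C by (intro mult_mono) auto
    also have "\<dots> = (C * C') * bracket x powr ((a + b) / 2)"
      by (simp add: add_divide_distrib powr_add)
    finally show ?thesis .
  qed
  then show ?case using C by (intro exI[of _ "C * C'"]) auto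
next
  case (symb_mono a h b)
  then obtain C where C: "C \<ge> 0" "\<And>x. \<bar>h x\<bar> \<le> C * bracket x powr (a / 2)" by metis
  have "C * bracket x powr (a / 2) \<le> C * bracket x powr (b / 2)" for x
    using C symb_mono by (intro mult_left_mono powr_mono) auto
  then show ?case using C by (meson order_trans)
next
  case (symb_powr a h c s)
  then obtain C where C: "C \<ge> 0" "\<And>x. \<bar>h x\<bar> \<le> C * bracket x powr (a / 2)" by metis
  have hpos: "0 < h x" for x using symb_powr lower_bound_pos by blast
  \<comment> \<open>The sum of the two constants serves both signs of \<open>s\<close>:
    \<open>C\<close> comes from the upper bound on \<open>h\<close>, \<open>c\<close> from the lower
    one.\<close>
  have "\<bar>h x powr s\<bar> \<le> (c powr s + C powr s) * bracket x powr (a * s / 2)" for x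
  proof (cases "s \<ge> 0")
    case True
    have "h x powr s \<le> (C * bracket x powr (a / 2)) powr s"
      using C(2)[of x] hpos[of x] True by (intro powr_mono2) auto
    also have "\<dots> = C powr s * bracket x powr (a * s / 2)"
      using C by (simp add: powr_mult powr_powr)
    finally show ?thesis by (simp add: distrib_right add_increasing)
  next
    case False
    have "h x powr s \<le> (c * bracket x powr (a / 2)) powr s"
      using symb_powr.hyps False by (intro powr_mono2') auto
    also have "\<dots> = c powr s * bracket x powr (a * s / 2)"
      using symb_powr.hyps by (simp add: powr_mult powr_powr)
    finally show ?thesis by (simp add: distrib_right add_increasing2)
  qed
  then show ?case by (intro exI[of _ "c powr s + C powr s"]) auto
qed

section \<open>Closure of symbols under algebra and differentiation\<close>

lemma symb_mult_le:
  "symb a h \<Longrightarrow> symb b k \<Longrightarrow> a + b \<le> d \<Longrightarrow> symb d (\<lambda>x. h x * k x)"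
  by (rule symb_mono[OF symb_mult])

lemma symb_const_nonneg: "0 \<le> d \<Longrightarrow> symb d (\<lambda>_. c)"
  by (rule symb_mono[OF symb_const])

lemma symb_cmult: "symb d h \<Longrightarrow> symb d (\<lambda>x. c * h x)"
  using symb_mult[OF symb_const, of d h c] by simp

lemma symb_minus: "symb d h \<Longrightarrow> symb d (\<lambda>x. - h x)"
  using symb_cmult[of d h "-1"] by simp

lemma symb_diff: "symb d h \<Longrightarrow> symb d k \<Longrightarrow> symb d (\<lambda>x. h x - k x)"
  using symb_add[OF _ symb_minus, of d h k] by simp

lemma symb_divide_const: "symb d h \<Longrightarrow> symb d (\<lambda>x. h x / c)"
  using symb_cmult[of d h "1 / c"] by simp

lemma symb_sum: "(\<And>i. i \<in> I \<Longrightarrow> symb d (h i)) \<Longrightarrow> symb d (\<lambda>x. \<Sum>i\<in>I. h i x)"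
  by (induction I rule: infinite_finite_induct) (auto intro: symb_zero symb_add)

lemma symb_bracket: "symb 2 bracket"
proof -
  have eq: "bracket = (\<lambda>x. 1 + (\<Sum>i\<in>UNIV. x $ i * x $ i))"
    by (simp add: bracket_def power2_norm_eq_inner inner_vec_def fun_eq_iff)
  show ?thesis
    unfolding eq
    by (intro symb_add symb_const_nonneg symb_sum symb_mult_le[OF symb_coord symb_coord]) auto
qed

lemma symb_bracket_powr: "symb (2 * s) (\<lambda>x. bracket x powr s)"
  by (rule symb_powr[OF symb_bracket, of 1]) (auto simp: less_imp_le)

lemma symb_powr_0:
  assumes "symb 0 h" "0 < c" "\<And>x. c \<le> h x"
  shows "symb 0 (\<lambda>x. h x powr s)"
  using symb_powr[OF assms(1,2), of s] assms(3) by simp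

lemma pd_add_fun: "symb a h \<Longrightarrow> symb b k \<Longrightarrow>
    pd i (\<lambda>y. h y + k y) = (\<lambda>x. pd i h x + pd i k x)"
  by (rule ext, rule pd_add) (auto intro: symb_differentiable)

lemma pd_mult_fun: "symb a h \<Longrightarrow> symb b k \<Longrightarrow>
    pd i (\<lambda>y. h y * k y) = (\<lambda>x. h x * pd i k x + pd i h x * k x)"
  by (rule ext, rule pd_mult) (auto intro: symb_differentiable)

lemma pd_cmult_fun: "symb a h \<Longrightarrow> pd i (\<lambda>y. c * h y) = (\<lambda>x. c * pd i h x)"
  using pd_mult_fun[OF symb_const, of a h i c] by simp

lemma pd_sum_fun: "finite I \<Longrightarrow> (\<And>j. j \<in> I \<Longrightarrow> symb d (h j)) \<Longrightarrow>
    pd i (\<lambda>y. \<Sum>j\<in>I. h j y) = (\<lambda>x. \<Sum>j\<in>I. pd i (h j) x)"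
  by (induction I rule: finite_induct) (auto simp: pd_add_fun[of d _ d] symb_sum)

lemma pd_powr_fun:
  assumes "symb a h" "0 < c" "\<And>x. c * bracket x powr (a / 2) \<le> h x"
  shows "pd i (\<lambda>y. h y powr s) = (\<lambda>x. s * (h x powr (s - 1) * pd i h x))"
proof
  fix x
  have "0 < h x" using assms lower_bound_pos by blast
  then show "pd i (\<lambda>y. h y powr s) x = s * (h x powr (s - 1) * pd i h x)"
    using pd_powr[OF symb_differentiable[OF assms(1)]] by simp
qed

text \<open>Product and chain rule express the derivative of each generator by generators again. For
  a power, the orders a (s - 1) and a - 1 add up to a s - 1.\<close>

lemma symb_pd: "symb d h \<Longrightarrow> symb (d - 1) (pd i h)"
proof (induction rule: symb.induct)
  case (symb_mono a h b)
  then show ?case using symb.symb_mono[of "a - 1" _ "b - 1"] by auto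
next
  case (symb_powr a h c s)
  then show ?case
    unfolding pd_powr_fun[OF symb_powr.hyps]
    by (intro symb_cmult symb_mult_le[OF symb.symb_powr[OF symb_powr.hyps] symb_powr.IH])
      (simp add: algebra_simps)
next
  case (symb_mult a h b k)
  then show ?case
    unfolding pd_mult_fun[OF symb_mult.hyps]
    by (intro symb_add symb_mult_le[OF symb_mult.hyps(1) symb_mult.IH(2)]
        symb_mult_le[OF symb_mult.IH(1) symb_mult.hyps(2)]) auto
qed (auto simp: pd_add_fun intro!: symb_zero symb_const_nonneg intro: symb_add)

text \<open>Induction along the rules of \<open>symb\<close>: the product and chain rules give
  second derivatives that are visibly symmetric in the two indices.\<close>

lemma pd_commute: "symb d h \<Longrightarrow> pd i (pd j h) = pd j (pd i h)"
proof (induction rule: symb.induct)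
  case (symb_add d h k)
  then show ?case by (simp add: pd_add_fun[OF symb_add.hyps] pd_add_fun[OF symb_pd symb_pd])
next
  case (symb_mult a h b k)
  have *: "pd i (pd j (\<lambda>x. h x * k x)) = (\<lambda>x. h x * pd i (pd j k) x + pd i h x * pd j k x
      + (pd j h x * pd i k x + pd i (pd j h) x * k x))" for i j
    by (simp add: pd_mult_fun[OF symb_mult.hyps]
        pd_mult_fun[OF symb_mult.hyps(1) symb_pd[OF symb_mult.hyps(2)]]
        pd_mult_fun[OF symb_pd[OF symb_mult.hyps(1)] symb_mult.hyps(2)]
        pd_add_fun[OF symb.symb_mult[OF symb_mult.hyps(1) symb_pd[OF symb_mult.hyps(2)]]
          symb.symb_mult[OF symb_pd[OF symb_mult.hyps(1)] symb_mult.hyps(2)]])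
  show ?case unfolding * using symb_mult.IH by (auto simp: algebra_simps)
next
  case (symb_powr a h c s)
  note S = symb_powr.hyps
  have *: "pd i (pd j (\<lambda>x. h x powr s)) = (\<lambda>x. s * (h x powr (s - 1) * pd i (pd j h) x
      + (s - 1) * (h x powr (s - 1 - 1) * pd i h x) * pd j h x))" for i j
    by (simp add: pd_powr_fun[OF S] pd_cmult_fun[OF symb_mult[OF symb.symb_powr[OF S] symb_pd[OF S(1)]]]
        pd_mult_fun[OF symb.symb_powr[OF S] symb_pd[OF S(1)]])
  show ?case unfolding * using symb_powr.IH by (auto simp: algebra_simps)
qed auto

lemma symb_iter_pd: "symb d h \<Longrightarrow> symb (d - real (length is)) (iter_pd is h)"
proof (induction "is")
  case (Cons i "is")
  then show ?case using symb_pd[of "d - real (length is)" "iter_pd is h" i]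
    by (simp add: iter_pd_def algebra_simps)
qed (simp add: iter_pd_def)

lemma symb_smooth: "symb d h \<Longrightarrow> smooth h"
  unfolding smooth_def using symb_iter_pd symb_differentiable by blast

text \<open>Outside the unit ball the bracket lies between |x|^2 and 2 |x|^2; the constant
  \<open>1 + 2 powr (d / 2)\<close> covers both signs of \<open>d\<close>.\<close>

lemma bracket_powr_le:
  assumes "1 \<le> norm x"
  shows "bracket x powr (d / 2) \<le> (1 + 2 powr (d / 2)) * norm x powr d"
proof -
  have n: "norm x powr d = ((norm x)\<^sup>2) powr (d / 2)"
    using assms by (simp add: powr_powr flip: powr_numeral)
  have le: "(norm x)\<^sup>2 \<le> bracket x" "bracket x \<le> 2 * (norm x)\<^sup>2"
    using assms power_mono[of 1 "norm x" 2] by (auto simp: bracket_def)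
  show ?thesis
  proof (cases "d \<ge> 0")
    case True
    then have "bracket x powr (d / 2) \<le> (2 * (norm x)\<^sup>2) powr (d / 2)"
      using le by (intro powr_mono2) (auto simp: less_imp_le)
    then show ?thesis by (simp add: n powr_mult distrib_right add_increasing)
  next
    case False
    then have "bracket x powr (d / 2) \<le> ((norm x)\<^sup>2) powr (d / 2)"
      using le assms by (intro powr_mono2') auto
    then show ?thesis by (simp add: n distrib_right add_increasing2)
  qed
qed

lemma bigo_at_infinityI:
  assumes "\<And>x. \<bar>h x\<bar> \<le> C * bracket x powr (d / 2)" "C \<ge> 0"
  shows "h \<in> O[at_infinity](\<lambda>x. norm x powr d)"
proof (rule bigoI[of _ "C * (1 + 2 powr (d / 2))"])
  have "\<forall>\<^sub>F x::real^3 in at_infinity. 1 \<le> norm x"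
    unfolding eventually_at_infinity by auto
  then show "\<forall>\<^sub>F x in at_infinity. norm (h x) \<le> C * (1 + 2 powr (d / 2)) * norm (norm x powr d)"
  proof eventually_elim
    case (elim x)
    have "\<bar>h x\<bar> \<le> C * bracket x powr (d / 2)" by (rule assms)
    also have "\<dots> \<le> C * ((1 + 2 powr (d / 2)) * norm x powr d)"
      using bracket_powr_le[OF elim] assms by (intro mult_left_mono) auto
    finally show ?case by simp
  qed
qed

lemma symb_bigo: "symb d h \<Longrightarrow> h \<in> O[at_infinity](\<lambda>x. norm x powr d)"
  using symb_bound bigo_at_infinityI by metis

lemma symb_bigo_derivs: "symb d h \<Longrightarrow> bigo_derivs l d h"
  unfolding bigo_derivs_def
  by (auto intro!: always_eventually symb_differentiable symb_bigo symb_iter_pd)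

section \<open>Integrals over spheres\<close>

text \<open>Integration against the solid angle: the factor r^2 of the area element is left
  out.\<close>

definition sphere_int :: "real \<Rightarrow> (real^3 \<Rightarrow> real) \<Rightarrow> real" where
  "sphere_int r G =
     integral (cbox (0, 0) (pi, 2 * pi)) (\<lambda>(\<theta>, \<phi>). sin \<theta> * G (spherical r (\<theta>, \<phi>)))"

lemma continuous_on_spherical: "continuous_on S (spherical r)"
  unfolding spherical_def case_prod_unfold
  by (subst continuous_on_componentwise)
     (auto simp: Basis_vec_def inner_axis forall_3 axis_eq_axis intro!: continuous_intros)

lemma continuous_on_sphere_density:
  assumes "continuous_on UNIV G"
  shows "continuous_on S (\<lambda>(\<theta>, \<phi>). sin \<theta> * G (spherical r (\<theta>, \<phi>)))"
proof -
  have "continuous_on S (\<lambda>z. G (spherical r z))"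
    using continuous_on_compose2[OF assms continuous_on_spherical] by simp
  then show ?thesis by (auto simp: case_prod_unfold intro!: continuous_intros)
qed

lemma sphere_density_integrable:
  assumes "continuous_on UNIV G"
  shows "(\<lambda>(\<theta>, \<phi>). sin \<theta> * G (spherical r (\<theta>, \<phi>))) integrable_on cbox (0, 0) (pi, 2 * pi)"
  by (rule integrable_continuous[OF continuous_on_sphere_density[OF assms]])

text \<open>The factor r^2 of the area element and the factor 1/r of the normal x/|x| leave a single
  r. All ADM integrands are brought to this form.\<close>

lemma sphere_area_flux:
  assumes "continuous_on UNIV G" "r > 0"
  shows "(LINT x|sphere_area r. G x / norm x) = r * sphere_int r G"
proof -
  define f where "f = (\<lambda>(\<theta>, \<phi>). sin \<theta> * G (spherical r (\<theta>, \<phi>)))"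
  have [measurable]: "G \<in> borel_measurable borel"
    using assms(1) by (rule borel_measurable_continuous_onI)
  have box: "{0..pi} \<times> {0..2 * pi} = cbox (0, 0) (pi, 2 * pi)"
    by (simp add: cbox_Pair_eq)
  have eq: "r\<^sup>2 * sin (fst z) * (G (spherical r z) / norm (spherical r z)) = r * f z" for z
    using assms(2) norm_spherical[of r "fst z" "snd z"]
    by (simp add: f_def case_prod_unfold power2_eq_square)
  have "continuous_on (cbox (0, 0) (pi, 2 * pi)) (\<lambda>z. r * f z)"
    unfolding f_def by (intro continuous_on_mult_left continuous_on_sphere_density assms)
  then have int: "set_integrable lborel (cbox (0, 0) (pi, 2 * pi)) (\<lambda>z. r * f z)"
    unfolding set_integrable_def by (intro borel_integrable_compact) auto
  have "(LINT x|sphere_area r. G x / norm x)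
      = (LINT z:{0..pi} \<times> {0..2 * pi}|lborel. r\<^sup>2 * sin (fst z) * (G (spherical r z) / norm (spherical r z)))"
    by (rule integral_sphere_area) measurable
  also have "\<dots> = (LINT z:cbox (0, 0) (pi, 2 * pi)|lborel. r * f z)"
    unfolding box eq ..
  also have "\<dots> = r * sphere_int r G"
    unfolding set_borel_integral_eq_integral(2)[OF int] by (simp add: sphere_int_def f_def)
  finally show ?thesis .
qed

text \<open>The constant 2 pi^2 is the area of the coordinate rectangle, with the sine estimated by
  1.\<close>

lemma sphere_int_bound:
  assumes "continuous_on UNIV G" "r \<ge> 0" "M \<ge> 0" "\<And>x. norm x = r \<Longrightarrow> \<bar>G x\<bar> \<le> M"
  shows "\<bar>sphere_int r G\<bar> \<le> 2 * pi\<^sup>2 * M"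
proof -
  have "norm (sphere_int r G) \<le> M * measure lborel (cbox (0::real, 0::real) (pi, 2 * pi))"
    unfolding sphere_int_def
  proof (rule has_integral_bound[OF assms(3) integrable_integral[OF sphere_density_integrable[OF assms(1)]]],
      clarify)
    fix \<theta> \<phi> :: real
    have "\<bar>sin \<theta>\<bar> * \<bar>G (spherical r (\<theta>, \<phi>))\<bar> \<le> 1 * M"
      using assms norm_spherical by (intro mult_mono) auto
    then show "norm (sin \<theta> * G (spherical r (\<theta>, \<phi>))) \<le> M" by (simp add: abs_mult)
  qed
  then show ?thesis by (simp add: content_Pair power2_eq_square mult_ac)
qed

lemma sphere_int_add:
  assumes "continuous_on UNIV G" "continuous_on UNIV H"
  shows "sphere_int r (\<lambda>x. G x + H x) = sphere_int r G + sphere_int r H"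
  unfolding sphere_int_def
  using integral_add[OF assms[THEN sphere_density_integrable], of r r]
  by (simp add: case_prod_unfold distrib_left)

lemma sphere_int_iterated:
  assumes "continuous_on UNIV G"
  shows "sphere_int r G =
    integral {0..pi} (\<lambda>\<theta>. sin \<theta> * integral {0..2 * pi} (\<lambda>\<phi>. G (spherical r (\<theta>, \<phi>))))"
  unfolding sphere_int_def
  by (subst integral_prod_continuous[OF continuous_on_sphere_density[OF assms]]) simp

section \<open>Vanishing of odd integrals over spheres\<close>

lemma integral_flip_real:
  fixes I :: "real \<Rightarrow> real"
  shows "integral {0..a} (\<lambda>x. I (a - x)) = integral {0..a} I"
  using integral_shift_real_ivl[of "-a" "-a" 0 "\<lambda>x. I (- x)"]
    Henstock_Kurzweil_Integration.integral_reflect_real[of a 0 I]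
  by simp

text \<open>The antipodal map moves the longitude by half a period. The shifted interval from p to
  3p is cut at 2p, and its second piece is moved back by a period.\<close>

lemma integral_half_period_shift:
  fixes g :: "real \<Rightarrow> real"
  assumes "continuous_on UNIV g" "\<And>x. g (x + 2 * p) = g x" "p \<ge> 0"
  shows "integral {0..2 * p} (\<lambda>x. g (x + p)) = integral {0..2 * p} g"
proof -
  have int: "g integrable_on {a..b}" for a b
    using assms(1) continuous_on_subset integrable_continuous_interval by blast
  have "integral {0..2 * p} (\<lambda>x. g (x + p)) = integral {p..3 * p} g"
    using integral_shift_real_ivl[of p p "3 * p" g] by simp
  also have "\<dots> = integral {p..2 * p} g + integral {2 * p..3 * p} g"
    using assms(3) by (intro Henstock_Kurzweil_Integration.integral_combine[symmetric] int) auto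
  also have "integral {2 * p..3 * p} g = integral {0..p} g"
    using integral_shift_real_ivl[of "2 * p" "2 * p" "3 * p" g] assms(2) by simp
  also have "integral {p..2 * p} g + integral {0..p} g = integral {0..2 * p} g"
    using assms(3) Henstock_Kurzweil_Integration.integral_combine[of 0 p "2 * p" g] int by simp
  finally show ?thesis .
qed

definition refl :: "(3 \<Rightarrow> real) \<Rightarrow> real^3 \<Rightarrow> real^3" where
  "refl \<sigma> x = (\<chi> i. \<sigma> i * x $ i)"

abbreviation antipode :: "3 \<Rightarrow> real" where
  "antipode \<equiv> \<lambda>_. -1"

abbreviation mirror3 :: "3 \<Rightarrow> real" where
  "mirror3 \<equiv> \<lambda>i. if i = 3 then -1 else 1"

text \<open>The mirror acts as \<theta> \<mapsto> pi - \<theta> and preserves sin \<theta>, so the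
  integral equals its own negative.\<close>

lemma sphere_int_odd_mirror:
  assumes "continuous_on UNIV G" "\<And>x. G (refl mirror3 x) = - G x"
  shows "sphere_int r G = 0"
proof -
  define I where "I \<theta> = sin \<theta> * integral {0..2 * pi} (\<lambda>\<phi>. G (spherical r (\<theta>, \<phi>)))" for \<theta>
  have "spherical r (pi - \<theta>, \<phi>) = refl mirror3 (spherical r (\<theta>, \<phi>))" for \<theta> \<phi>
    by (simp add: vec_eq_iff forall_3 refl_def spherical_def)
  then have "I (pi - \<theta>) = - I \<theta>" for \<theta>
    by (simp add: I_def assms(2))
  then have "integral {0..pi} I = - integral {0..pi} I"
    using integral_flip_real[of pi I] by simp
  then show ?thesis unfolding sphere_int_iterated[OF assms(1)] I_def[symmetric] by simp
qed

text \<open>The antipodal map acts as \<theta> \<mapsto> pi - \<theta> together with \<phi>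
  \<mapsto> \<phi> + pi; both substitutions preserve the integral.\<close>

lemma sphere_int_odd:
  assumes "continuous_on UNIV G" "\<And>x. G (refl antipode x) = - G x"
  shows "sphere_int r G = 0"
proof -
  define I where "I \<theta> = sin \<theta> * integral {0..2 * pi} (\<lambda>\<phi>. G (spherical r (\<theta>, \<phi>)))" for \<theta>
  have *: "spherical r (pi - \<theta>, \<phi> + pi) = refl antipode (spherical r (\<theta>, \<phi>))" for \<theta> \<phi>
    by (simp add: vec_eq_iff forall_3 refl_def spherical_def)
  have "I (pi - \<theta>) = - I \<theta>" for \<theta>
  proof -
    have "continuous_on UNIV (\<lambda>\<phi>. G (spherical r (pi - \<theta>, \<phi>)))"
      by (rule continuous_on_compose2[OF assms(1)]
          continuous_on_compose2[OF continuous_on_spherical[of UNIV]] continuous_intros | simp)+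
    moreover have "spherical r (pi - \<theta>, \<phi> + 2 * pi) = spherical r (pi - \<theta>, \<phi>)" for \<phi>
      by (simp add: spherical_def)
    ultimately have "I (pi - \<theta>) = sin \<theta> * integral {0..2 * pi} (\<lambda>\<phi>. G (spherical r (pi - \<theta>, \<phi> + pi)))"
      by (subst integral_half_period_shift) (simp_all add: I_def)
    then show ?thesis by (simp add: * assms(2) I_def)
  qed
  then have "integral {0..pi} I = - integral {0..pi} I"
    using integral_flip_real[of pi I] by simp
  then show ?thesis unfolding sphere_int_iterated[OF assms(1)] I_def[symmetric] by simp
qed

text \<open>The flux of a symbol of order d is O(r powr (d + 1)). Order -1 is the borderline at
  which a finite nonzero limit can occur.\<close>

lemma symb_flux_tendsto_0:
  assumes "symb d G" "d < -1"
  shows "((\<lambda>r. r * sphere_int r G) \<longlongrightarrow> 0) at_top"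
proof -
  obtain C where C: "C \<ge> 0" "\<And>x. \<bar>G x\<bar> \<le> C * bracket x powr (d / 2)"
    using symb_bound[OF assms(1)] by metis
  define D where "D = 2 * pi\<^sup>2 * (C * (1 + 2 powr (d / 2)))"
  have "\<forall>\<^sub>F r in at_top. norm (r * sphere_int r G) \<le> D * r powr (d + 1)"
    using eventually_ge_at_top[of 1]
  proof eventually_elim
    case (elim r)
    have "\<bar>sphere_int r G\<bar> \<le> 2 * pi\<^sup>2 * (C * ((1 + 2 powr (d / 2)) * r powr d))"
    proof (rule sphere_int_bound[OF symb_continuous[OF assms(1)]])
      fix x :: "real^3" assume x: "norm x = r"
      have "\<bar>G x\<bar> \<le> C * bracket x powr (d / 2)" by (rule C)
      also have "\<dots> \<le> C * ((1 + 2 powr (d / 2)) * r powr d)"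
        using bracket_powr_le[of x d] C elim x by (intro mult_left_mono) auto
      finally show "\<bar>G x\<bar> \<le> \<dots>" .
    qed (use C elim in auto)
    then have "r * \<bar>sphere_int r G\<bar> \<le> r * (2 * pi\<^sup>2 * (C * ((1 + 2 powr (d / 2)) * r powr d)))"
      using elim by (intro mult_left_mono) auto
    also have "\<dots> = D * r powr (d + 1)"
      using elim by (simp add: D_def powr_add)
    finally show ?case using elim by (simp add: abs_mult)
  qed
  moreover have "((\<lambda>r. D * r powr (d + 1)) \<longlongrightarrow> 0) at_top"
    using assms(2) by (intro tendsto_mult_right_zero tendsto_neg_powr filterlim_ident) auto
  ultimately show ?thesis by (rule Lim_null_comparison)
qed

section \<open>Graphs of symbols of order one third\<close>

text \<open>For square matrices a right inverse is also a left inverse, which identifies the inverse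
  that \<open>matrix_inv\<close> chooses.\<close>

lemma matrix_inv_eqI:
  fixes A B :: "real^'n^'n"
  assumes "A ** B = mat 1"
  shows "matrix_inv A = B"
proof -
  have "A ** B = mat 1 \<and> B ** A = mat 1"
    using assms matrix_left_right_inverse by blast
  then have "matrix_inv A ** A = mat 1"
    unfolding matrix_inv_def by (rule someI2) simp
  then have "matrix_inv A ** (A ** B) = B" by (simp add: matrix_mul_assoc)
  then show ?thesis using assms by simp
qed

lemma pd_const_add_fun: "symb a h \<Longrightarrow> pd i (\<lambda>y. c + h y) = pd i h"
  using pd_add_fun[OF symb_const, of a h i c] by simp

lemma sphere_area_tendsto:
  assumes "symb d G" "\<And>x. F x = G x / norm x"
    and "((\<lambda>r. r * sphere_int r G) \<longlongrightarrow> l) at_top"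
  shows "((\<lambda>r. c * (LINT x|sphere_area r. F x)) \<longlongrightarrow> c * l) at_top"
proof -
  have "\<forall>\<^sub>F r in at_top. r * sphere_int r G = (LINT x|sphere_area r. F x)"
    using eventually_gt_at_top[of 0] unfolding assms(2)
    by eventually_elim (simp add: sphere_area_flux[OF symb_continuous[OF assms(1)]])
  then have "((\<lambda>r. LINT x|sphere_area r. F x) \<longlongrightarrow> l) at_top"
    using assms(3) by (rule Lim_transform_eventually[rotated])
  then show ?thesis by (rule tendsto_mult_left)
qed

text \<open>The bound 1/2 keeps 1 - |df|^2 away from 0, so that its real powers are symbols of order
  0.\<close>

locale small_graph =
  fixes f :: "real^3 \<Rightarrow> real"
  assumes symb_f: "symb (1/3) f"
    and slope_le: "(\<Sum>i\<in>UNIV. pd i f x * pd i f x) \<le> 1/2"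
begin

section \<open>Metric, inverse metric and second fundamental form as symbols\<close>

definition slope :: "real^3 \<Rightarrow> real" where
  "slope x = (\<Sum>i\<in>UNIV. pd i f x * pd i f x)"

text \<open>The Lorentz factor of the graph, that is, the time component of its unit normal, written
  as a real power to fit the rules of \<open>symb\<close>.\<close>

definition tilt :: "real^3 \<Rightarrow> real" where
  "tilt x = (1 - slope x) powr (-1/2)"

abbreviation "g \<equiv> induced_metric f"
abbreviation "k \<equiv> second_form f"

lemma smooth_f: "smooth f"
  using symb_f by (rule symb_smooth)

lemma norm_grad: "(norm (grad f x))\<^sup>2 = slope x"
  by (simp add: power2_norm_eq_inner inner_vec_def grad_def slope_def)

lemma slope_bounds: "0 \<le> slope x" "slope x \<le> 1/2"
  using slope_le by (auto simp: slope_def intro: sum_nonneg)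

lemma spacelike: "spacelike_graph f"
proof -
  have "norm (grad f x) < 1" for x
    using norm_grad[of x] slope_bounds(2)[of x] power2_less_imp_less[of "norm (grad f x)" 1] by simp
  then show ?thesis using spacelike_graph_iff[OF smooth_f] by blast
qed

lemma tilt_sq: "tilt x * tilt x * (1 - slope x) = 1"
proof -
  have "tilt x * tilt x = (1 - slope x) powr -1"
    by (simp add: tilt_def flip: powr_add)
  then show ?thesis using slope_bounds(2)[of x] by (simp add: powr_minus)
qed

lemma tilt_ge_1: "1 \<le> tilt x"
proof -
  have "1 = 1 powr (-1/2 :: real)" by simp
  also have "\<dots> \<le> tilt x"
    unfolding tilt_def using slope_bounds[of x] by (intro powr_mono2') auto
  finally show ?thesis .
qed

lemma metric_eq: "g x $ i $ j = (mat 1 :: real^3^3) $ i $ j - pd i f x * pd j f x"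
  by (rule induced_metric_graph[OF smooth_f])

text \<open>The Sherman-Morrison formula for the rank-one perturbation of the identity by df, with 1
  / (1 - |df|^2) written as \<open>tilt x * tilt x\<close>.\<close>

lemma metric_inv_eq:
  "matrix_inv (g x) $ i $ j = (mat 1 :: real^3^3) $ i $ j + pd i f x * pd j f x * (tilt x * tilt x)"
proof -
  define B :: "real^3^3" where
    "B = (\<chi> i j. (mat 1 :: real^3^3) $ i $ j + pd i f x * pd j f x * (tilt x * tilt x))"
  have c: "(\<Sum>l\<in>UNIV. g x $ i $ l * B $ l $ j) = (mat 1 :: real^3^3) $ i $ j
      + pd i f x * pd j f x * (tilt x * tilt x * (1 - slope x) - 1)" for i j
    unfolding B_def metric_eq slope_def
    using exhaust_3[of i] exhaust_3[of j] by (auto simp: sum_3 mat_def algebra_simps)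
  have "g x ** B = mat 1"
    by (simp add: vec_eq_iff matrix_matrix_mult_def c tilt_sq)
  then have "matrix_inv (g x) = B" by (rule matrix_inv_eqI)
  then show ?thesis by (simp add: B_def)
qed

lemma second_form_eq: "k x $ i $ j = pd i (pd j f) x * tilt x"
proof -
  have "tilt x = 1 / sqrt (1 - slope x)"
    using slope_bounds(2)[of x] by (simp add: tilt_def powr_minus_divide flip: powr_half_sqrt)
  then show ?thesis
    by (simp add: second_form_graph[OF smooth_f] norm_grad)
qed

lemma symb_d1: "symb (-2/3) (pd i f)"
  using symb_pd[OF symb_f, of i] by simp

lemma symb_d2: "symb (-5/3) (pd i (pd j f))"
  using symb_pd[OF symb_d1, of i j] by simp

lemma symb_slope: "symb (-4/3) slope"
  unfolding slope_def by (intro symb_sum symb_mult_le[OF symb_d1 symb_d1]) simp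

lemma symb_tilt: "symb 0 tilt"
  unfolding tilt_def
proof (rule symb_powr_0[of _ "1/2"])
  show "symb 0 (\<lambda>x. 1 - slope x)"
    by (intro symb_diff symb_const symb_mono[OF symb_slope]) simp
qed (use slope_bounds in \<open>auto simp: field_simps\<close>)

lemma symb_tilt_plus_inv: "symb 0 (\<lambda>x. (tilt x + 1) powr -1)"
proof (rule symb_powr_0[of _ 1])
  show "1 \<le> tilt x + 1" for x using tilt_ge_1[of x] by simp
qed (auto intro!: symb_add symb_tilt symb_const)

text \<open>Writing w for the tilt, (w - 1) (w + 1) = w^2 - 1 = slope * w^2; dividing by w + 1 \<ge>
  2 shows that w - 1 inherits the decay of the slope.\<close>

lemma tilt_minus_1: "tilt x - 1 = slope x * (tilt x * tilt x) * (tilt x + 1) powr -1"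
proof -
  have "(tilt x - 1) * (tilt x + 1) = slope x * (tilt x * tilt x)"
    using tilt_sq[of x] by (simp add: algebra_simps)
  then show ?thesis
    using tilt_ge_1[of x] by (simp add: powr_minus eq_divide_eq flip: divide_inverse)
qed

lemma symb_tilt_minus_1: "symb (-4/3) (\<lambda>x. tilt x - 1)"
  unfolding tilt_minus_1
  by (rule symb_mult_le symb_slope symb_tilt symb_tilt_plus_inv order_refl | simp)+

text \<open>The remainder of the first-order expansion in the slope. It contains both the slope and
  tilt - 1, hence decays with twice the order -4/3.\<close>

lemma tilt_expansion: "tilt x - 1 - slope x / 2
    = slope x * ((tilt x - 1) * ((2 * tilt x + 1) * (tilt x + 1) powr -1)) / 2"
proof -
  have "(tilt x - 1) * (tilt x + 1) = slope x * (tilt x * tilt x)"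
    using tilt_sq[of x] by (simp add: algebra_simps)
  then have "(tilt x - 1 - slope x / 2) * (tilt x + 1)
      = slope x * ((tilt x - 1) * (2 * tilt x + 1)) / 2"
    by (simp add: field_simps)
  then show ?thesis
    using tilt_ge_1[of x] by (simp add: powr_minus field_simps)
qed

lemma symb_tilt_expansion: "symb (-8/3) (\<lambda>x. tilt x - 1 - slope x / 2)"
  unfolding tilt_expansion
  by (rule symb_divide_const symb_mult_le[OF symb_slope] symb_mult_le[OF symb_tilt_minus_1]
      symb_mult_le[OF _ symb_tilt_plus_inv] symb_add symb_cmult symb_const symb_tilt order_refl | simp)+

lemma symb_metric_diff: "symb (-4/3) (\<lambda>x. g x $ i $ j - (mat 1 :: real^3^3) $ i $ j)"
  unfolding metric_eq using symb_minus[OF symb_mult_le[OF symb_d1 symb_d1]] by simp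

lemma symb_metric: "symb 0 (\<lambda>x. g x $ i $ j)"
  unfolding metric_eq
  by (rule symb_diff symb_const symb_mult_le[OF symb_d1 symb_d1] | simp)+

text \<open>The identity matrix is subtracted before differentiating: the order 0 of the metric
  alone would only give order -1.\<close>

lemma symb_pd_metric: "symb (-7/3) (pd l (\<lambda>x. g x $ i $ j))"
proof -
  have "pd l (\<lambda>x. g x $ i $ j) = pd l (\<lambda>x. g x $ i $ j - (mat 1 :: real^3^3) $ i $ j)"
    using pd_const_add_fun[OF symb_metric_diff, of l "(mat 1 :: real^3^3) $ i $ j" i j] by simp
  then show ?thesis using symb_pd[OF symb_metric_diff, of l i j] by simp
qed

lemma symb_inv_correction: "symb (-4/3) (\<lambda>x. pd i f x * pd j f x * (tilt x * tilt x))"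
  by (rule symb_mult_le symb_d1 symb_tilt order_refl | simp)+

lemma symb_metric_inv: "symb 0 (\<lambda>x. matrix_inv (g x) $ i $ j)"
  unfolding metric_inv_eq
  by (rule symb_add symb_const symb_mono[OF symb_inv_correction] | simp)+

lemma symb_second_form: "symb (-5/3) (\<lambda>x. k x $ i $ j)"
  unfolding second_form_eq by (rule symb_mult_le[OF symb_d2 symb_tilt]) simp

text \<open>The part of the second fundamental form beyond the Hessian, hence of degree at least
  three in f.\<close>

definition excess :: "3 \<Rightarrow> 3 \<Rightarrow> real^3 \<Rightarrow> real" where
  "excess i j x = pd i (pd j f) x * (tilt x - 1)"

lemma second_form_split: "k x $ i $ j = pd i (pd j f) x + excess i j x"
  by (simp add: second_form_eq excess_def algebra_simps)

lemma symb_excess: "symb (-3) (excess i j)"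
  unfolding excess_def by (rule symb_mult_le[OF symb_d2 symb_tilt_minus_1]) simp

section \<open>Curvature and constraint densities\<close>

lemma symb_christoffel: "symb (-7/3) (christoffel g l i j)"
  unfolding christoffel_def
  by (rule symb_divide_const symb_sum symb_mult_le[OF symb_metric_inv, of "-7/3"]
      symb_add symb_diff symb_pd_metric | simp)+

lemma symb_ricci: "symb (-10/3) (ricci g i j)"
  unfolding ricci_def
  by (rule symb_add symb_sum symb_diff symb_mult_le[OF symb_christoffel symb_christoffel]
      symb_mono[OF symb_pd[OF symb_christoffel]] | simp)+

lemma symb_scalar_curvature: "symb (-10/3) (scalar_curvature g)"
  unfolding scalar_curvature_def
  by (rule symb_sum symb_mult_le[OF symb_metric_inv symb_ricci] | simp)+

lemma symb_trace: "symb (-5/3) (metric_trace g k)"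
  unfolding metric_trace_def
  by (rule symb_sum symb_mult_le[OF symb_metric_inv symb_second_form] | simp)+

lemma symb_tensor_norm_sq: "symb (-10/3) (tensor_norm_sq g k)"
  unfolding tensor_norm_sq_def
  by (rule symb_sum symb_mult_le[OF _ symb_second_form, of "-5/3"]
      symb_mult_le[OF _ symb_second_form, of 0] symb_mult_le[OF symb_metric_inv symb_metric_inv] | simp)+

lemma symb_energy_density: "symb (-10/3) (energy_density g k)"
  unfolding energy_density_def power2_eq_square
  by (rule symb_divide_const symb_add symb_diff symb_scalar_curvature symb_tensor_norm_sq
      symb_mult_le[OF symb_trace symb_trace] | simp)+

definition laplacian :: "real^3 \<Rightarrow> real" where
  "laplacian x = (\<Sum>i\<in>UNIV. pd i (pd i f) x)"

definition trace_excess :: "real^3 \<Rightarrow> real" where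
  "trace_excess x = (\<Sum>i\<in>UNIV. excess i i x)
     + (\<Sum>i\<in>UNIV. \<Sum>j\<in>UNIV. pd i f x * pd j f x * (tilt x * tilt x) * k x $ i $ j)"

text \<open>Splits a contraction with the inverse metric into the flat contraction and its
  correction; this serves both the trace and the divergence.\<close>

lemma sum_mat_1:
  "(\<Sum>i\<in>UNIV. \<Sum>j\<in>UNIV. ((mat 1 :: real^3^3) $ i $ j + b i j) * c i j)
    = (\<Sum>i\<in>UNIV. c i i) + (\<Sum>i\<in>UNIV. \<Sum>j\<in>UNIV. b i j * c i j)"
  by (simp add: sum_3 mat_def algebra_simps)

lemma trace_eq: "metric_trace g k x = laplacian x + trace_excess x"
  unfolding metric_trace_def metric_inv_eq sum_mat_1 laplacian_def trace_excess_def
  by (simp add: second_form_split sum.distrib)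

lemma symb_laplacian: "symb (-5/3) laplacian"
  unfolding laplacian_def by (intro symb_sum symb_d2)

lemma symb_trace_excess: "symb (-3) trace_excess"
  unfolding trace_excess_def
  by (rule symb_add symb_sum symb_excess symb_mult_le[OF symb_inv_correction symb_second_form] | simp)+

lemma symb_cov_rest: "symb (-4) (\<lambda>x. \<Sum>m\<in>UNIV. christoffel g m a i x * k x $ m $ j
    + christoffel g m a j x * k x $ i $ m)"
  by (rule symb_sum symb_add symb_mult_le[OF symb_christoffel symb_second_form] | simp)+

lemma symb_cov_deriv: "symb (-8/3) (cov_deriv g k a i j)"
  unfolding cov_deriv_def
  by (rule symb_diff symb_mono[OF symb_cov_rest] symb_mono[OF symb_pd[OF symb_second_form]] | simp)+

text \<open>The terms linear in \<open>f\<close>, of order \<open>-8/3\<close>, cancel because partial derivatives commute.\<close>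

lemma symb_momentum_density: "symb (-4) (momentum_density g k j)"
proof -
  have kd: "pd a (\<lambda>y. k y $ i $ j) x = pd a (pd i (pd j f)) x + pd a (excess i j) x" for a i j x
    by (simp add: second_form_split pd_add_fun[OF symb_d2 symb_excess])
  have tr: "pd j (metric_trace g k) x = pd j laplacian x + pd j trace_excess x" for x
    by (simp add: trace_eq[abs_def] pd_add_fun[OF symb_laplacian symb_trace_excess])
  have lap: "pd j laplacian x = (\<Sum>a\<in>UNIV. pd a (pd a (pd j f)) x)" for x
    unfolding laplacian_def
    by (simp add: pd_sum_fun[OF _ symb_d2] pd_commute[OF symb_d1, of j] pd_commute[OF symb_f, of j])
  have "momentum_density g k j = (\<lambda>x.
      (\<Sum>a\<in>UNIV. pd a (excess a j) x - (\<Sum>m\<in>UNIV. christoffel g m a a x * k x $ m $ j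
        + christoffel g m a j x * k x $ a $ m))
      + (\<Sum>a\<in>UNIV. \<Sum>i\<in>UNIV. pd a f x * pd i f x * (tilt x * tilt x) * cov_deriv g k a i j x)
      - pd j trace_excess x)"
    unfolding momentum_density_def divergence_def metric_inv_eq sum_mat_1 tr lap
    by (rule ext) (simp add: cov_deriv_def kd sum.distrib sum_subtractf)
  then show ?thesis
    by (simp only:)
      (rule symb_add symb_diff symb_sum symb_cov_rest symb_mono[OF symb_pd[OF symb_excess]]
        symb_mono[OF symb_pd[OF symb_trace_excess]]
        symb_mult_le[OF symb_inv_correction symb_cov_deriv] | simp)+
qed

text \<open>The square root of a symbol need not be differentiable where the covector vanishes, so
  only a bound is extracted from the quadratic form of order \<open>2 * d\<close>.\<close>

lemma bigo_covector_norm: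
  assumes "\<And>i. symb d (w i)"
  shows "covector_norm g w \<in> O[at_infinity](\<lambda>x. norm x powr d)"
proof -
  have "symb (2 * d) (\<lambda>x. \<Sum>i\<in>UNIV. \<Sum>j\<in>UNIV. matrix_inv (g x) $ i $ j * w i x * w j x)"
    by (rule symb_sum symb_mult_le[OF _ assms, of d] symb_mult_le[OF symb_metric_inv assms] | simp)+
  then obtain C where C: "C \<ge> 0"
    "\<And>x. \<bar>\<Sum>i\<in>UNIV. \<Sum>j\<in>UNIV. matrix_inv (g x) $ i $ j * w i x * w j x\<bar> \<le> C * bracket x powr d"
    using symb_bound by fastforce
  show ?thesis
  proof (rule bigo_at_infinityI[of _ "sqrt C"])
    fix x
    \<comment> \<open>\<open>sqrt\<close> is odd on the reals, so a bound on the absolute value of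
      the quadratic form suffices.\<close>
    have "\<bar>sqrt y\<bar> = sqrt \<bar>y\<bar>" for y :: real
      by (simp add: abs_if real_sqrt_minus)
    then have "\<bar>covector_norm g w x\<bar> \<le> sqrt (C * bracket x powr d)"
      unfolding covector_norm_def using C(2)[of x] by simp
    also have "\<dots> = sqrt C * bracket x powr (d / 2)"
      by (simp add: real_sqrt_mult powr_powr flip: powr_half_sqrt)
    finally show "\<bar>covector_norm g w x\<bar> \<le> sqrt C * bracket x powr (d / 2)" .
  qed (use C in auto)
qed

lemma flat: "asymptotically_flat g k"
  unfolding asymptotically_flat_def
\<comment> \<open>The witnesses are q = 4/3, p = 5/3 and \<epsilon> = 1/3; the last comes from the
  order -10/3 of the energy density.\<close>
proof (intro exI conjI allI)
  show "bigo_derivs 2 (- (4/3)) (\<lambda>x. g x $ i $ j - (mat 1 :: real^3^3) $ i $ j)" for i j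
    using symb_bigo_derivs[OF symb_metric_diff] by simp
  show "bigo_derivs 1 (- (5/3)) (\<lambda>x. k x $ i $ j)" for i j
    using symb_bigo_derivs[OF symb_second_form] by simp
  show "energy_density g k \<in> O[at_infinity](\<lambda>x. norm x powr (- 3 - 1/3))"
    using symb_bigo[OF symb_energy_density] by simp
  have "symb (-10/3) (momentum_density g k i)" for i
    using symb_mono[OF symb_momentum_density] by simp
  then show "covector_norm g (momentum_density g k) \<in> O[at_infinity](\<lambda>x. norm x powr (- 3 - 1/3))"
    using bigo_covector_norm[of "-10/3" "momentum_density g k"] by simp
qed auto

text \<open>The first derivatives of the metric have order -7/3, so with the factor x the integrand
  has order -4/3, below the borderline -1.\<close>

lemma energy_zero: "has_ADM_energy g 0"
proof -
  define G where "G x = (\<Sum>j\<in>UNIV. \<Sum>l\<in>UNIV.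
    (pd l (\<lambda>y. g y $ j $ l) x - pd j (\<lambda>y. g y $ l $ l) x) * x $ j)" for x
  have G: "symb (-4/3) G"
    unfolding G_def
    by (rule symb_sum symb_mult_le[OF _ symb_coord, of "-7/3"] symb_diff symb_pd_metric | simp)+
  have "(\<Sum>j\<in>UNIV. \<Sum>l\<in>UNIV. (pd l (\<lambda>y. g y $ j $ l) x - pd j (\<lambda>y. g y $ l $ l) x)
      * (x $ j / norm x)) = G x / norm x" for x
    by (simp add: G_def sum_divide_distrib)
  from sphere_area_tendsto[OF G this symb_flux_tendsto_0[OF G], of "1 / (16 * pi)"]
  show ?thesis unfolding has_ADM_energy_def by simp
qed

end

section \<open>Parity under sign changes of the coordinates\<close>

lemma bounded_linear_refl: "bounded_linear (refl \<sigma>)"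
  unfolding linear_conv_bounded_linear[symmetric]
  by (rule linearI) (simp_all add: refl_def vec_eq_iff algebra_simps)

text \<open>The chain rule, since \<open>refl \<sigma>\<close> maps the i-th basis vector to its
  multiple by \<open>\<sigma> i\<close>. The sign \<tau> allows a second application, to a first
  derivative.\<close>

lemma pd_refl_parity:
  fixes h :: "real^3 \<Rightarrow> real"
  assumes "symb d h" "\<And>x. h (refl \<sigma> x) = \<tau> * h x" "\<And>i. \<sigma> i * \<sigma> i = 1"
  shows "pd i h (refl \<sigma> x) = \<tau> * \<sigma> i * pd i h x"
proof -
  let ?D = "frechet_derivative h (at (refl \<sigma> x))"
  have D: "(h has_derivative ?D) (at (refl \<sigma> x))"
    by (rule has_derivative_pd[OF symb_differentiable[OF assms(1)]])
  have "((\<lambda>y. h (refl \<sigma> y)) has_derivative (\<lambda>v. ?D (refl \<sigma> v))) (at x)"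
    using has_derivative_compose[OF bounded_linear_imp_has_derivative[OF bounded_linear_refl] D] .
  then have "pd i (\<lambda>y. h (refl \<sigma> y)) x = ?D (refl \<sigma> (axis i 1))" by (rule pd_eqI)
  moreover have "refl \<sigma> (axis i 1) = \<sigma> i *\<^sub>R axis i 1"
    by (simp add: refl_def vec_eq_iff axis_def)
  moreover have "?D (\<sigma> i *\<^sub>R axis i 1) = \<sigma> i * pd i h (refl \<sigma> x)"
    using linear_scale[OF has_derivative_linear[OF D]] by (simp add: pd_def)
  moreover have "pd i (\<lambda>y. h (refl \<sigma> y)) x = \<tau> * pd i h x"
    using pd_cmult_fun[OF assms(1)] by (simp add: assms(2))
  ultimately have "\<sigma> i * (\<tau> * pd i h x) = \<sigma> i * \<sigma> i * pd i h (refl \<sigma> x)" by simp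
  then show ?thesis using assms(3) by (simp add: mult_ac)
qed

lemma rotation_field_nth:
  "rotation_field 1 x = vector [0, - x $ 3, x $ 2]"
  "rotation_field 2 x = vector [x $ 3, 0, - x $ 1]"
  "rotation_field 3 x = vector [- x $ 2, x $ 1, 0]"
  by (simp_all add: rotation_field_def cross3_def axis_def)

lemma symb_rotation_field: "symb 1 (\<lambda>x. rotation_field i x $ j)"
  using exhaust_3[of i] exhaust_3[of j]
  by (elim disjE) (simp_all add: rotation_field_nth symb_zero symb_coord symb_minus)

context small_graph
begin

lemma conjugate_momentum_nth:
  "conjugate_momentum g k x $ i $ j = k x $ i $ j - metric_trace g k x * g x $ i $ j"
  by (simp add: conjugate_momentum_def)

lemma symb_conjugate_momentum: "symb (-5/3) (\<lambda>x. conjugate_momentum g k x $ i $ j)"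
  unfolding conjugate_momentum_nth
  by (rule symb_diff symb_second_form symb_mult_le[OF symb_trace symb_metric] | simp)+

text \<open>If f is invariant, every tensor built from its derivatives picks up one sign per index,
  and contracted indices contribute \<sigma> twice, hence nothing.\<close>

lemma conjugate_momentum_parity:
  assumes "\<And>x. f (refl \<sigma> x) = f x" "\<And>i. \<sigma> i * \<sigma> i = 1"
  shows "conjugate_momentum g k (refl \<sigma> x) $ i $ j = \<sigma> i * \<sigma> j * conjugate_momentum g k x $ i $ j"
proof -
  have s: "\<sigma> i * (\<sigma> i * a) = a" for i a
    using assms(2)[of i] by (simp flip: mult.assoc)
  have d1: "pd i f (refl \<sigma> x) = \<sigma> i * pd i f x" for i x
    using pd_refl_parity[OF symb_f, of \<sigma> 1] assms by simp
  have d2: "pd i (pd j f) (refl \<sigma> x) = \<sigma> i * \<sigma> j * pd i (pd j f) x" for i j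
    using pd_refl_parity[OF symb_d1 d1 assms(2)] by (simp add: mult_ac)
  have "slope (refl \<sigma> x) = slope x"
    by (simp add: slope_def d1 s mult_ac)
  then have t: "tilt (refl \<sigma> x) = tilt x" by (simp add: tilt_def)
  have d: "(mat 1 :: real^3^3) $ i $ j = \<sigma> i * \<sigma> j * (mat 1 :: real^3^3) $ i $ j" for i j
    using assms(2) by (simp add: mat_def)
  have g: "g (refl \<sigma> x) $ i $ j = \<sigma> i * \<sigma> j * g x $ i $ j" for i j
    unfolding metric_eq d1 using d[of i j] by (simp add: algebra_simps)
  have ginv: "matrix_inv (g (refl \<sigma> x)) $ i $ j = \<sigma> i * \<sigma> j * matrix_inv (g x) $ i $ j" for i j
    unfolding metric_inv_eq d1 t using d[of i j] by (simp add: algebra_simps)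
  have k: "k (refl \<sigma> x) $ i $ j = \<sigma> i * \<sigma> j * k x $ i $ j" for i j
    by (simp add: second_form_eq d2 t)
  have "metric_trace g k (refl \<sigma> x) = metric_trace g k x"
    unfolding metric_trace_def ginv k by (simp add: mult_ac s)
  then show ?thesis
    unfolding conjugate_momentum_nth by (simp add: g k algebra_simps)
qed

definition momentum_flux :: "3 \<Rightarrow> real^3 \<Rightarrow> real" where
  "momentum_flux i x = (\<Sum>l\<in>UNIV. conjugate_momentum g k x $ i $ l * x $ l)"

definition angular_flux :: "3 \<Rightarrow> real^3 \<Rightarrow> real" where
  "angular_flux i x =
    (\<Sum>j\<in>UNIV. \<Sum>l\<in>UNIV. conjugate_momentum g k x $ j $ l * rotation_field i x $ j * x $ l)"

lemma symb_momentum_flux: "symb (-2/3) (momentum_flux i)"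
  unfolding momentum_flux_def
  by (rule symb_sum symb_mult_le[OF symb_conjugate_momentum symb_coord] | simp)+

lemma symb_angular_flux: "symb (1/3) (angular_flux i)"
  unfolding angular_flux_def
  by (rule symb_sum symb_mult_le[OF _ symb_coord, of "-2/3"]
      symb_mult_le[OF symb_conjugate_momentum symb_rotation_field] | simp)+

lemma has_ADM_momentumI:
  assumes "((\<lambda>r. r * sphere_int r (momentum_flux i)) \<longlongrightarrow> 8 * pi * P) at_top"
  shows "has_ADM_momentum g k i P"
proof -
  have "(\<Sum>l\<in>UNIV. conjugate_momentum g k x $ i $ l * (x $ l / norm x)) = momentum_flux i x / norm x" for x
    by (simp add: momentum_flux_def sum_divide_distrib)
  from sphere_area_tendsto[OF symb_momentum_flux this assms, of "1 / (8 * pi)"]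
  show ?thesis unfolding has_ADM_momentum_def by simp
qed

lemma has_ADM_angular_momentumI:
  assumes "((\<lambda>r. r * sphere_int r (angular_flux i)) \<longlongrightarrow> 8 * pi * L) at_top"
  shows "has_ADM_angular_momentum g k (rotation_field i) L"
proof -
  have "(\<Sum>j\<in>UNIV. \<Sum>l\<in>UNIV. conjugate_momentum g k x $ j $ l * rotation_field i x $ j
      * (x $ l / norm x)) = angular_flux i x / norm x" for x
    by (simp add: angular_flux_def sum_divide_distrib)
  from sphere_area_tendsto[OF symb_angular_flux this assms, of "1 / (8 * pi)"]
  show ?thesis unfolding has_ADM_angular_momentum_def by simp
qed

text \<open>Two indices make the conjugate momentum even under the antipodal map, while the normal
  is odd.\<close>

lemma momentum_zero:
  assumes "\<And>x. f (refl antipode x) = f x"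
  shows "has_ADM_momentum g k i 0"
proof (rule has_ADM_momentumI)
  have "conjugate_momentum g k (refl antipode x) $ i $ j = conjugate_momentum g k x $ i $ j" for x i j
    using conjugate_momentum_parity[of antipode] assms by simp
  then have "momentum_flux i (refl antipode x) = - momentum_flux i x" for x
    by (simp add: momentum_flux_def refl_def sum_negf)
  then show "((\<lambda>r. r * sphere_int r (momentum_flux i)) \<longlongrightarrow> 8 * pi * 0) at_top"
    using sphere_int_odd[OF symb_continuous[OF symb_momentum_flux]] by simp
qed

text \<open>The mirror in the third coordinate reverses rotations about the first two axes, so their
  fluxes are odd; rotation about the third axis is preserved.\<close>

lemma angular_momentum_zero:
  assumes "\<And>x. f (refl mirror3 x) = f x" "i \<noteq> 3"
  shows "has_ADM_angular_momentum g k (rotation_field i) 0"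
proof (rule has_ADM_angular_momentumI)
  have *: "conjugate_momentum g k (refl mirror3 x) $ i $ j
      = mirror3 i * mirror3 j * conjugate_momentum g k x $ i $ j" for x i j
    using conjugate_momentum_parity[of mirror3 x i j] assms(1) by simp
  have "angular_flux i (refl mirror3 x) = - angular_flux i x" for x
    unfolding angular_flux_def * using exhaust_3[of i] assms(2)
    by (elim disjE) (simp_all add: refl_def rotation_field_nth sum_3)
  then show "((\<lambda>r. r * sphere_int r (angular_flux i)) \<longlongrightarrow> 8 * pi * 0) at_top"
    using sphere_int_odd_mirror[OF symb_continuous[OF symb_angular_flux]] by simp
qed

section \<open>Expansion of the angular momentum flux about the third axis\<close>

definition radial :: "real^3 \<Rightarrow> real" where
  "radial x = (\<Sum>l\<in>UNIV. pd l f x * x $ l)"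

definition angular :: "real^3 \<Rightarrow> real" where
  "angular x = (\<Sum>j\<in>UNIV. pd j f x * rotation_field 3 x $ j)"

text \<open>As \<open>radial\<close> is r d/dr f and \<open>angular\<close> is d/d\<phi> f, this is
  (r d/dr - 1) d/d\<phi> f, an exact derivative along circles of latitude.\<close>

definition angular_hessian :: "real^3 \<Rightarrow> real" where
  "angular_hessian x =
    (\<Sum>j\<in>UNIV. \<Sum>l\<in>UNIV. pd j (pd l f) x * rotation_field 3 x $ j * x $ l)"

definition cubic_flux :: "real^3 \<Rightarrow> real" where
  "cubic_flux x = slope x / 2 * angular_hessian x + laplacian x * angular x * radial x"

definition rest_flux :: "real^3 \<Rightarrow> real" where
  "rest_flux x = (tilt x - 1 - slope x / 2) * angular_hessian x
     + trace_excess x * angular x * radial x"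

text \<open>The rotation field is orthogonal to x in the flat metric, so the induced metric pairs
  them to \<open>- angular x * radial x\<close>. Then the tilt and the trace are expanded.\<close>

lemma angular_flux_eq: "angular_flux 3 x = angular_hessian x + (cubic_flux x + rest_flux x)"
proof -
  have "angular_flux 3 x = tilt x * angular_hessian x + metric_trace g k x * angular x * radial x"
    unfolding angular_flux_def conjugate_momentum_nth second_form_eq metric_eq
      angular_hessian_def angular_def radial_def
    by (simp add: sum_3 rotation_field_nth mat_def algebra_simps)
  then show ?thesis
    by (simp add: trace_eq cubic_flux_def rest_flux_def algebra_simps)
qed

lemma symb_radial: "symb (1/3) radial"
  unfolding radial_def by (rule symb_sum symb_mult_le[OF symb_d1 symb_coord] | simp)+

lemma symb_angular: "symb (1/3) angular"
  unfolding angular_def by (rule symb_sum symb_mult_le[OF symb_d1 symb_rotation_field] | simp)+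

lemma symb_angular_hessian: "symb (1/3) angular_hessian"
  unfolding angular_hessian_def
  by (rule symb_sum symb_mult_le[OF _ symb_coord, of "-2/3"]
      symb_mult_le[OF symb_d2 symb_rotation_field] | simp)+

lemma symb_rest_flux: "symb (-7/3) rest_flux"
  unfolding rest_flux_def
  by (rule symb_add symb_mult_le[OF symb_tilt_expansion symb_angular_hessian]
      symb_mult_le[OF _ symb_radial, of "-8/3"] symb_mult_le[OF symb_trace_excess symb_angular] | simp)+

lemma symb_cubic_flux: "symb (-1) cubic_flux"
  unfolding cubic_flux_def
  by (rule symb_add symb_mult_le[OF symb_divide_const[OF symb_slope] symb_angular_hessian]
      symb_mult_le[OF _ symb_radial, of "-4/3"] symb_mult_le[OF symb_laplacian symb_angular] | simp)+

text \<open>Decay alone does not control the linear part: order 1/3 would permit growth like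
  r^(4/3), so its integral has to vanish on each sphere. The rest, of order -7/3, drops out in the
  limit.\<close>

lemma angular_momentum_limit:
  assumes "\<And>r. r > 0 \<Longrightarrow> sphere_int r angular_hessian = 0"
    and "((\<lambda>r. r * sphere_int r cubic_flux) \<longlongrightarrow> 8 * pi * L) at_top"
  shows "has_ADM_angular_momentum g k (rotation_field 3) L"
proof (rule has_ADM_angular_momentumI)
  have eq: "sphere_int r (angular_flux 3) = sphere_int r angular_hessian
      + (sphere_int r cubic_flux + sphere_int r rest_flux)" for r
    unfolding angular_flux_eq[abs_def]
    by (simp add: sphere_int_add symb_continuous[OF symb_angular_hessian]
        symb_continuous[OF symb_cubic_flux] symb_continuous[OF symb_rest_flux]
        symb_continuous[OF symb_add[OF symb_cubic_flux symb_mono[OF symb_rest_flux]]])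
  have "\<forall>\<^sub>F r in at_top. r * sphere_int r cubic_flux + r * sphere_int r rest_flux
      = r * sphere_int r (angular_flux 3)"
    using eventually_gt_at_top[of 0] by eventually_elim (simp add: eq assms(1) distrib_left)
  moreover have "((\<lambda>r. r * sphere_int r cubic_flux + r * sphere_int r rest_flux)
      \<longlongrightarrow> 8 * pi * L + 0) at_top"
    by (intro tendsto_add assms(2) symb_flux_tendsto_0[OF symb_rest_flux]) simp
  ultimately show "((\<lambda>r. r * sphere_int r (angular_flux 3)) \<longlongrightarrow> 8 * pi * L) at_top"
    by (simp add: tendsto_cong)
qed

end

section \<open>An explicit graph\<close>

definition quartic :: "real^3 \<Rightarrow> real" where
  "quartic x = x $ 1 * (x $ 1 * (x $ 1 * x $ 2))"

text \<open>The exponent is fixed by 4 - 2 * 11/6 = 1/3.\<close>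

definition profile :: "real^3 \<Rightarrow> real" where
  "profile x = quartic x * bracket x powr (-11/6)"

lemma symb_quartic: "symb 4 quartic"
  unfolding quartic_def
  by (rule symb_mult_le[OF symb_coord, of 3] symb_mult_le[OF symb_coord, of 2]
      symb_mult_le[OF symb_coord symb_coord] | simp)+

lemma symb_profile: "symb (1/3) profile"
  unfolding profile_def by (rule symb_mult_le[OF symb_quartic symb_bracket_powr]) simp

lemma pd_bracket: "pd i bracket = (\<lambda>x. 2 * x $ i)"
proof -
  have eq: "bracket = (\<lambda>x. 1 + (\<Sum>j\<in>UNIV. x $ j * x $ j))"
    by (simp add: bracket_def power2_norm_eq_inner inner_vec_def fun_eq_iff)
  have sq: "symb 2 (\<lambda>x. x $ j * x $ j)" for j
    by (rule symb_mult_le[OF symb_coord symb_coord]) simp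
  show ?thesis
    unfolding eq pd_const_add_fun[OF symb_sum[OF sq]] pd_sum_fun[OF finite sq]
    using exhaust_3[of i] by (auto simp: pd_mult_fun[OF symb_coord symb_coord] sum_3)
qed

lemma pd_mult_bracket_powr:
  assumes "symb a h"
  shows "pd i (\<lambda>x. h x * bracket x powr s)
    = (\<lambda>x. pd i h x * bracket x powr s + 2 * s * (x $ i * h x) * bracket x powr (s - 1))"
proof -
  have "pd i (\<lambda>x. bracket x powr s) = (\<lambda>x. s * (bracket x powr (s - 1) * (2 * x $ i)))"
    using pd_powr_fun[OF symb_bracket, of 1 i s] by (simp add: pd_bracket less_imp_le)
  then show ?thesis
    by (simp add: pd_mult_fun[OF assms symb_bracket_powr] algebra_simps)
qed

lemma pd_pd_mult_bracket_powr:
  assumes "symb a h"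
  shows "pd i (pd j (\<lambda>x. h x * bracket x powr s)) x
    = pd i (pd j h) x * bracket x powr s
      + 2 * s * (x $ i * pd j h x + x $ j * pd i h x + (if i = j then h x else 0)) * bracket x powr (s - 1)
      + 4 * s * (s - 1) * (x $ i * x $ j * h x) * bracket x powr (s - 2)"
proof -
  have S: "symb (a + 1) (\<lambda>x. 2 * s * (x $ j * h x))"
    by (rule symb_cmult symb_mult_le[OF symb_coord assms] | simp)+
  have p: "pd i (\<lambda>x. 2 * s * (x $ j * h x)) x = 2 * s * (x $ j * pd i h x + (if i = j then h x else 0))"
    by (simp add: pd_cmult_fun[OF symb_mult[OF symb_coord assms]] pd_mult_fun[OF symb_coord assms])
  have S1: "symb (a - 1 + 2 * s) (\<lambda>x. pd j h x * bracket x powr s)"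
    by (rule symb_mult_le[OF symb_pd[OF assms] symb_bracket_powr]) simp
  have S2: "symb (a - 1 + 2 * s) (\<lambda>x. 2 * s * (x $ j * h x) * bracket x powr (s - 1))"
    by (rule symb_mult_le[OF S symb_bracket_powr]) simp
  show ?thesis
    unfolding pd_mult_bracket_powr[OF assms] pd_add_fun[OF S1 S2]
      pd_mult_bracket_powr[OF symb_pd[OF assms]] pd_mult_bracket_powr[OF S] p
    by (simp add: algebra_simps)
qed

lemma pd_quartic: "pd i quartic = (\<lambda>x. if i = 1 then 3 * (x $ 1 * (x $ 1 * x $ 2))
    else if i = 2 then x $ 1 * (x $ 1 * x $ 1) else 0)"
proof -
  note S = symb_mult[OF symb_coord symb_coord]
  show ?thesis
    unfolding quartic_def[abs_def] using exhaust_3[of i]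
    by (elim disjE) (simp_all add: pd_mult_fun[OF symb_coord symb_coord] pd_mult_fun[OF symb_coord S]
        pd_mult_fun[OF symb_coord symb_mult[OF symb_coord S]] algebra_simps)
qed

lemma pd_pd_quartic: "pd i (pd j quartic) x =
   (if i = 1 \<and> j = 1 then 6 * (x $ 1 * x $ 2)
    else if i = 1 \<and> j = 2 \<or> i = 2 \<and> j = 1 then 3 * (x $ 1 * x $ 1) else 0)"
proof -
  note S = symb_mult[OF symb_coord symb_coord]
  have "pd i (\<lambda>x. 3 * (x $ 1 * (x $ 1 * x $ 2))) x =
      (if i = 1 then 6 * (x $ 1 * x $ 2) else if i = 2 then 3 * (x $ 1 * x $ 1) else 0)"
    using exhaust_3[of i]
    by (elim disjE) (simp_all add: pd_mult_fun[OF symb_coord symb_coord] pd_mult_fun[OF symb_coord S]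
        pd_cmult_fun[OF symb_mult[OF symb_coord S]])
  moreover have "pd i (\<lambda>x. x $ 1 * (x $ 1 * x $ 1)) x = (if i = 1 then 3 * (x $ 1 * x $ 1) else 0)"
    using exhaust_3[of i]
    by (elim disjE) (simp_all add: pd_mult_fun[OF symb_coord symb_coord] pd_mult_fun[OF symb_coord S])
  ultimately show ?thesis
    unfolding pd_quartic using exhaust_3[of j] by (elim disjE) simp_all
qed

lemma ex_scale:
  obtains \<epsilon> :: real where "\<epsilon> > 0" "\<And>x. (\<Sum>i\<in>UNIV. pd i (\<lambda>x. \<epsilon> * profile x) x * pd i (\<lambda>x. \<epsilon> * profile x) x) \<le> 1/2"
proof -
  have d1: "symb (-2/3) (pd i profile)" for i
    using symb_pd[OF symb_profile, of i] by simp
  have "symb 0 (\<lambda>x. \<Sum>i\<in>UNIV. pd i profile x * pd i profile x)"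
    by (rule symb_sum symb_mult_le[OF d1 d1] | simp)+
  then obtain C where C: "C \<ge> 0" "\<And>x. \<bar>\<Sum>i\<in>UNIV. pd i profile x * pd i profile x\<bar> \<le> C"
    using symb_bound by fastforce
  \<comment> \<open>The slope scales by \<epsilon>^2, and \<epsilon>^2 C \<le> 1/2; adding 1 to C
    avoids a zero denominator.\<close>
  define \<epsilon> where "\<epsilon> = 1 / sqrt (2 * (C + 1))"
  have e: "\<epsilon> > 0" "\<epsilon> * \<epsilon> = 1 / (2 * (C + 1))"
    using C by (auto simp: \<epsilon>_def)
  have "(\<Sum>i\<in>UNIV. pd i (\<lambda>x. \<epsilon> * profile x) x * pd i (\<lambda>x. \<epsilon> * profile x) x) \<le> 1/2" for x
  proof -
    have "(\<Sum>i\<in>UNIV. pd i (\<lambda>x. \<epsilon> * profile x) x * pd i (\<lambda>x. \<epsilon> * profile x) x)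
        = \<epsilon> * \<epsilon> * (\<Sum>i\<in>UNIV. pd i profile x * pd i profile x)"
      by (simp add: pd_cmult_fun[OF symb_profile] sum_distrib_left mult_ac)
    also have "\<dots> \<le> \<epsilon> * \<epsilon> * C"
      using C(2)[of x] by (intro mult_left_mono) auto
    also have "\<dots> \<le> 1/2" unfolding e(2) using C(1) by (simp add: divide_simps)
    finally show ?thesis .
  qed
  with e(1) show ?thesis by (rule that)
qed

lemma spherical_nth:
  "spherical r (\<theta>, \<phi>) $ 1 = r * sin \<theta> * cos \<phi>"
  "spherical r (\<theta>, \<phi>) $ 2 = r * sin \<theta> * sin \<phi>"
  "spherical r (\<theta>, \<phi>) $ 3 = r * cos \<theta>"
  by (simp_all add: spherical_def)

section \<open>Trigonometric integrals\<close>

definition moment :: real where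
  "moment = integral {0..2 * pi} (\<lambda>\<phi>. cos \<phi> ^ 6 * sin \<phi> ^ 4)"

text \<open>A continuous nonnegative function with zero integral vanishes identically, which one
  positive value excludes.\<close>

lemma integral_nonneg_pos:
  fixes F :: "real \<Rightarrow> real"
  assumes "continuous_on {a..b} F" "\<And>x. x \<in> {a..b} \<Longrightarrow> F x \<ge> 0" "c \<in> {a..b}" "F c > 0" "a < b"
  shows "integral {a..b} F > 0"
proof -
  have "integral {a..b} F \<ge> 0"
    using assms(2) by (intro integral_nonneg integrable_continuous_interval assms(1)) auto
  moreover have "integral {a..b} F \<noteq> 0"
    using integral_eq_0_iff[OF assms(1) _ assms(2)] assms by force
  ultimately show ?thesis by simp
qed

lemma moment_pos: "moment > 0"
  unfolding moment_def
  by (rule integral_nonneg_pos[where c = "pi / 4"])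
    (auto intro!: continuous_intros simp: cos_45 sin_45)

lemma sin_moment_pos: "integral {0..pi} (\<lambda>\<theta>. sin \<theta> * sin \<theta> ^ 10) > 0"
  by (rule integral_nonneg_pos[where c = "pi / 2"])
    (auto intro!: continuous_intros mult_nonneg_nonneg zero_le_power sin_ge_zero)

text \<open>Up to derivatives of trigonometric polynomials, every integrand of the cubic flux is a
  multiple of \<open>cos\<^sup>6 \<phi> sin\<^sup>4 \<phi>\<close>, so that only the sign of its integral matters.\<close>

lemma integral_longitude:
  "((\<lambda>\<phi>. \<alpha> * ((cos \<phi> ^ 6 + 9 * cos \<phi> ^ 4 * sin \<phi> ^ 2) * (cos \<phi> ^ 4 - 3 * cos \<phi> ^ 2 * sin \<phi> ^ 2))
       + \<beta> * (cos \<phi> ^ 4 * sin \<phi> ^ 2 * (cos \<phi> ^ 4 - 3 * cos \<phi> ^ 2 * sin \<phi> ^ 2))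
       + \<gamma> * ((cos \<phi> ^ 3 * sin \<phi>) ^ 2 * (cos \<phi> ^ 4 - 3 * cos \<phi> ^ 2 * sin \<phi> ^ 2)))
    has_integral (8 * \<alpha> - 2 / 3 * \<beta>) * moment) {0..2 * pi}"
proof -
  \<comment> \<open>The factors 5 and 1/3 match the terms in cos^10 and cos^8 sin^2. With u = cos^3
    sin, the last factor of each integrand is u', so the \<gamma>-term is the derivative of u^3 /
    3.\<close>
  define F :: "real \<Rightarrow> real" where "F = (\<lambda>\<phi>. \<alpha> * (cos \<phi> ^ 9 * sin \<phi> + 5 * (cos \<phi> ^ 7 * sin \<phi> ^ 3))
    + \<beta> * (cos \<phi> ^ 7 * sin \<phi> ^ 3 / 3) + \<gamma> * ((cos \<phi> ^ 3 * sin \<phi>) ^ 3 / 3))"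
  define F' :: "real \<Rightarrow> real" where "F' = (\<lambda>\<phi>.
    \<alpha> * (cos \<phi> ^ 10 + 6 * (cos \<phi> ^ 8 * sin \<phi> ^ 2) - 35 * (cos \<phi> ^ 6 * sin \<phi> ^ 4))
    + \<beta> * (cos \<phi> ^ 8 * sin \<phi> ^ 2 - 7 / 3 * (cos \<phi> ^ 6 * sin \<phi> ^ 4))
    + \<gamma> * ((cos \<phi> ^ 3 * sin \<phi>) ^ 2 * (cos \<phi> ^ 4 - 3 * cos \<phi> ^ 2 * sin \<phi> ^ 2)))"
  have "(F has_real_derivative F' \<phi>) (at \<phi>)" for \<phi>
    unfolding F_def F'_def
    by (rule derivative_eq_intros refl | simp)+ (simp add: eval_nat_numeral field_simps)
  then have "(F' has_integral (F (2 * pi) - F 0)) {0..2 * pi}"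
    by (intro fundamental_theorem_of_calculus)
      (auto simp flip: has_real_derivative_iff_has_vector_derivative intro: DERIV_subset)
  moreover have "F (2 * pi) - F 0 = 0" by (simp add: F_def)
  ultimately have 1: "(F' has_integral 0) {0..2 * pi}" by simp
  have "((\<lambda>\<phi>. cos \<phi> ^ 6 * sin \<phi> ^ 4) has_integral moment) {0..2 * pi}"
    unfolding moment_def by (intro integrable_integral integrable_continuous_interval continuous_intros)
  from has_integral_add[OF 1 has_integral_mult_right[OF this, of "8 * \<alpha> - 2 / 3 * \<beta>"]]
  have "((\<lambda>\<phi>. F' \<phi> + (8 * \<alpha> - 2 / 3 * \<beta>) * (cos \<phi> ^ 6 * sin \<phi> ^ 4))
    has_integral (8 * \<alpha> - 2 / 3 * \<beta>) * moment) {0..2 * pi}" by simp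
  moreover have "(\<lambda>\<phi>. F' \<phi> + (8 * \<alpha> - 2 / 3 * \<beta>) * (cos \<phi> ^ 6 * sin \<phi> ^ 4)) =
     (\<lambda>\<phi>. \<alpha> * ((cos \<phi> ^ 6 + 9 * cos \<phi> ^ 4 * sin \<phi> ^ 2) * (cos \<phi> ^ 4 - 3 * cos \<phi> ^ 2 * sin \<phi> ^ 2))
       + \<beta> * (cos \<phi> ^ 4 * sin \<phi> ^ 2 * (cos \<phi> ^ 4 - 3 * cos \<phi> ^ 2 * sin \<phi> ^ 2))
       + \<gamma> * ((cos \<phi> ^ 3 * sin \<phi>) ^ 2 * (cos \<phi> ^ 4 - 3 * cos \<phi> ^ 2 * sin \<phi> ^ 2)))"
    unfolding F'_def by (rule ext) (simp add: eval_nat_numeral algebra_simps)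
  ultimately show ?thesis by simp
qed

section \<open>Fluxes of the scaled profile\<close>

locale scaled_profile =
  fixes \<epsilon> :: real
  assumes eps_pos: "\<epsilon> > 0"
    and slope_le: "(\<Sum>i\<in>UNIV. pd i (\<lambda>x. \<epsilon> * profile x) x * pd i (\<lambda>x. \<epsilon> * profile x) x) \<le> 1/2"
begin

sublocale small_graph "\<lambda>x. \<epsilon> * profile x"
  by unfold_locales (rule symb_cmult symb_profile slope_le)+

text \<open>The derivative of \<open>quartic\<close> along the rotation about the third
  axis.\<close>

definition "quartic_rot x = x $ 1 ^ 4 - 3 * x $ 1 ^ 2 * x $ 2 ^ 2" for x :: "real^3"

text \<open>The powers of the bracket on the sphere of radius r, where they are constant; j counts
  the derivatives that fell on the bracket.\<close>

definition "pw r j = (1 + r\<^sup>2) powr (-11/6 - j)" for r j :: real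

text \<open>On the sphere of radius r, r d/dr turns \<open>profile\<close> into this multiple of
  \<open>quartic\<close>; the 4 is the degree of homogeneity.\<close>

definition "rad_coeff r = 4 * pw r 0 - 11/3 * r\<^sup>2 * pw r 1" for r :: real

lemma bracket_eq: "norm x = r \<Longrightarrow> bracket x = 1 + r\<^sup>2"
  by (simp add: bracket_def)

lemma d1_eq:
  assumes "norm x = r"
  shows "pd i (\<lambda>x. \<epsilon> * profile x) x
    = \<epsilon> * (pd i quartic x * pw r 0 - 11/3 * (x $ i * quartic x) * pw r 1)"
  unfolding pd_cmult_fun[OF symb_profile] unfolding profile_def[abs_def]
    pd_mult_bracket_powr[OF symb_quartic] bracket_eq[OF assms] by (simp add: pw_def)

text \<open>With s = -11/6 the coefficients are 2 s = -11/3 and 4 s (s - 1) = 187/9.\<close>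

lemma d2_eq:
  assumes "norm x = r"
  shows "pd i (pd j (\<lambda>x. \<epsilon> * profile x)) x = \<epsilon> * (pd i (pd j quartic) x * pw r 0
      - 11/3 * (x $ i * pd j quartic x + x $ j * pd i quartic x + (if i = j then quartic x else 0)) * pw r 1
      + 187/9 * (x $ i * x $ j * quartic x) * pw r 2)"
  unfolding pd_cmult_fun[OF symb_profile] pd_cmult_fun[OF symb_pd[OF symb_profile]]
  unfolding profile_def[abs_def] pd_pd_mult_bracket_powr[OF symb_quartic] bracket_eq[OF assms]
  by (simp add: pw_def)

lemma norm_sq: "norm x = r \<Longrightarrow> r\<^sup>2 = x $ 1 * x $ 1 + x $ 2 * x $ 2 + x $ 3 * x $ 3" for x :: "real^3"
  by (auto simp: power2_norm_eq_inner inner_vec_def sum_3)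

context
  fixes x :: "real^3" and r :: real
  assumes norm_x: "norm x = r"
begin

lemma radial_eq: "radial x = \<epsilon> * rad_coeff r * quartic x"
  unfolding radial_def d1_eq[OF norm_x] sum_3 pd_quartic quartic_def rad_coeff_def norm_sq[OF norm_x]
  by (simp add: algebra_simps)

lemma angular_eq: "angular x = \<epsilon> * pw r 0 * quartic_rot x"
  unfolding angular_def d1_eq[OF norm_x] sum_3 pd_quartic quartic_def quartic_rot_def
  by (simp add: rotation_field_nth eval_nat_numeral algebra_simps)

lemma angular_hessian_eq: "angular_hessian x = \<epsilon> * (rad_coeff r - pw r 0) * quartic_rot x"
  unfolding angular_hessian_def d2_eq[OF norm_x] sum_3 pd_pd_quartic
  unfolding pd_quartic quartic_def quartic_rot_def rad_coeff_def norm_sq[OF norm_x]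
  by (simp add: rotation_field_nth eval_nat_numeral) (simp add: field_simps)

text \<open>By Euler's relation for degree 4 in dimension 3, the middle coefficient is -11/3 * (2 *
  4 + 3) = -121/3.\<close>

lemma laplacian_eq: "laplacian x = \<epsilon> * (pw r 0 * 6 * (x $ 1 * x $ 2)
     + (187/9 * r\<^sup>2 * pw r 2 - 121/3 * pw r 1) * quartic x)"
  unfolding laplacian_def d2_eq[OF norm_x] sum_3 pd_pd_quartic
  unfolding pd_quartic quartic_def norm_sq[OF norm_x] by (simp add: field_simps)

lemma slope_eq: "slope x = \<epsilon>\<^sup>2 * ((pw r 0)\<^sup>2 * (x $ 1 ^ 6 + 9 * x $ 1 ^ 4 * x $ 2 ^ 2)
     + (121/9 * r\<^sup>2 * (pw r 1)\<^sup>2 - 88/3 * (pw r 0 * pw r 1)) * (quartic x)\<^sup>2)"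
  unfolding slope_def d1_eq[OF norm_x] sum_3
  unfolding pd_quartic quartic_def norm_sq[OF norm_x]
  by (simp add: eval_nat_numeral) (simp add: field_simps)

text \<open>The longitudinal derivative \<open>quartic_rot\<close> factors out of every term. The
  three groups are those weighted by \<alpha>, \<beta>, \<gamma> in
  \<open>integral_longitude\<close>.\<close>

lemma cubic_flux_eq: "cubic_flux x = \<epsilon> ^ 3 *
    ((rad_coeff r - pw r 0) * (pw r 0)\<^sup>2 / 2 * ((x $ 1 ^ 6 + 9 * x $ 1 ^ 4 * x $ 2 ^ 2) * quartic_rot x)
     + 6 * (pw r 0)\<^sup>2 * rad_coeff r * (x $ 1 * x $ 2 * quartic x * quartic_rot x)
     + ((rad_coeff r - pw r 0) / 2 * (121/9 * r\<^sup>2 * (pw r 1)\<^sup>2 - 88/3 * (pw r 0 * pw r 1))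
        + pw r 0 * rad_coeff r * (187/9 * r\<^sup>2 * pw r 2 - 121/3 * pw r 1)) * ((quartic x)\<^sup>2 * quartic_rot x))"
  unfolding cubic_flux_def slope_eq angular_hessian_eq laplacian_eq angular_eq radial_eq
  by (simp add: field_simps power2_eq_square power3_eq_cube)

end

lemma quartic_rot_spherical: "quartic_rot (spherical r (\<theta>, \<phi>))
    = (r * sin \<theta>) ^ 4 * (cos \<phi> ^ 4 - 3 * cos \<phi> ^ 2 * sin \<phi> ^ 2)"
  unfolding quartic_rot_def spherical_nth
  by (simp add: power_mult_distrib) (simp add: algebra_simps)

lemma quartic_spherical: "quartic (spherical r (\<theta>, \<phi>)) = (r * sin \<theta>) ^ 4 * (cos \<phi> ^ 3 * sin \<phi>)"
  unfolding quartic_def spherical_nth by (simp add: eval_nat_numeral mult_ac)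

text \<open>On a circle of latitude the integrand is a multiple of the derivative of cos^3 \<phi>
  sin \<phi>, which is periodic.\<close>

lemma sphere_int_angular_hessian:
  assumes "r > 0"
  shows "sphere_int r angular_hessian = 0"
proof -
  have "integral {0..2 * pi} (\<lambda>\<phi>. angular_hessian (spherical r (\<theta>, \<phi>))) = 0" for \<theta>
  proof -
    define F where "F \<phi> = cos \<phi> ^ 3 * sin \<phi>" for \<phi> :: real
    have "(F has_real_derivative cos \<phi> ^ 4 - 3 * cos \<phi> ^ 2 * sin \<phi> ^ 2) (at \<phi>)" for \<phi>
      unfolding F_def
      by (rule derivative_eq_intros refl | simp)+ (simp add: eval_nat_numeral algebra_simps)
    then have "((\<lambda>\<phi>. cos \<phi> ^ 4 - 3 * cos \<phi> ^ 2 * sin \<phi> ^ 2) has_integral (F (2 * pi) - F 0)) {0..2 * pi}"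
      by (intro fundamental_theorem_of_calculus)
        (auto simp flip: has_real_derivative_iff_has_vector_derivative intro: DERIV_subset)
    then have "((\<lambda>\<phi>. cos \<phi> ^ 4 - 3 * cos \<phi> ^ 2 * sin \<phi> ^ 2) has_integral 0) {0..2 * pi}"
      by (simp add: F_def)
    then show ?thesis
      using assms by (simp add: angular_hessian_eq[OF norm_spherical] quartic_rot_spherical integral_unique)
  qed
  then show ?thesis
    by (simp add: sphere_int_iterated[OF symb_continuous[OF symb_angular_hessian]])
qed

lemma sphere_int_cubic_flux:
  assumes "r > 0"
  shows "sphere_int r cubic_flux
    = - 4 * \<epsilon> ^ 3 * (pw r 0) ^ 3 * r ^ 10 * moment * integral {0..pi} (\<lambda>\<theta>. sin \<theta> * sin \<theta> ^ 10)"
proof -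
  define R where "R \<theta> = r * sin \<theta>" for \<theta>
  define \<gamma> where "\<gamma> = (rad_coeff r - pw r 0) / 2 * (121/9 * r\<^sup>2 * (pw r 1)\<^sup>2 - 88/3 * (pw r 0 * pw r 1))
        + pw r 0 * rad_coeff r * (187/9 * r\<^sup>2 * pw r 2 - 121/3 * pw r 1)"
  have "cubic_flux (spherical r (\<theta>, \<phi>)) =
     \<epsilon> ^ 3 * R \<theta> ^ 10 * ((rad_coeff r - pw r 0) * (pw r 0)\<^sup>2 / 2)
         * ((cos \<phi> ^ 6 + 9 * cos \<phi> ^ 4 * sin \<phi> ^ 2) * (cos \<phi> ^ 4 - 3 * cos \<phi> ^ 2 * sin \<phi> ^ 2))
     + \<epsilon> ^ 3 * R \<theta> ^ 10 * (6 * (pw r 0)\<^sup>2 * rad_coeff r)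
         * (cos \<phi> ^ 4 * sin \<phi> ^ 2 * (cos \<phi> ^ 4 - 3 * cos \<phi> ^ 2 * sin \<phi> ^ 2))
     + \<epsilon> ^ 3 * R \<theta> ^ 12 * \<gamma>
         * ((cos \<phi> ^ 3 * sin \<phi>) ^ 2 * (cos \<phi> ^ 4 - 3 * cos \<phi> ^ 2 * sin \<phi> ^ 2))" for \<theta> \<phi>
    unfolding cubic_flux_eq[OF norm_spherical[OF less_imp_le[OF assms]]] \<gamma>_def[symmetric]
      quartic_rot_spherical quartic_spherical spherical_nth R_def[symmetric]
    by (simp add: power_mult_distrib distrib_left eval_nat_numeral mult_ac)
  then have "integral {0..2 * pi} (\<lambda>\<phi>. cubic_flux (spherical r (\<theta>, \<phi>)))
      = (8 * (\<epsilon> ^ 3 * R \<theta> ^ 10 * ((rad_coeff r - pw r 0) * (pw r 0)\<^sup>2 / 2))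
        - 2 / 3 * (\<epsilon> ^ 3 * R \<theta> ^ 10 * (6 * (pw r 0)\<^sup>2 * rad_coeff r))) * moment" for \<theta>
    by (simp only: integral_longitude[THEN integral_unique])
  \<comment> \<open>The radial derivatives cancel: 4 (\<open>rad_coeff r\<close> -
    \<open>pw r 0\<close>) - 4 \<open>rad_coeff r\<close> = -4 \<open>pw r 0\<close>, each times
    (\<open>pw r 0\<close>)^2.\<close>
  also have "\<dots> \<theta> = - 4 * \<epsilon> ^ 3 * (pw r 0) ^ 3 * r ^ 10 * moment * sin \<theta> ^ 10" for \<theta>
    by (simp add: R_def field_simps power2_eq_square power3_eq_cube)
  finally show ?thesis
    by (simp add: sphere_int_iterated[OF symb_continuous[OF symb_cubic_flux]] mult.left_commute[of "sin _"])
qed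

text \<open>The dependence on r is r * r^10 * (1 + r^2)^(-11/2), which tends to 1.\<close>

lemma flux_limit: "((\<lambda>r. r * sphere_int r cubic_flux) \<longlongrightarrow>
    - 4 * \<epsilon> ^ 3 * moment * integral {0..pi} (\<lambda>\<theta>. sin \<theta> * sin \<theta> ^ 10)) at_top"
proof -
  have "((\<lambda>r. r ^ 11 * (pw r 0) ^ 3) \<longlongrightarrow> 1) at_top"
    unfolding pw_def by real_asymp
  from tendsto_mult_left[OF this, of "- 4 * \<epsilon> ^ 3 * moment * integral {0..pi} (\<lambda>\<theta>. sin \<theta> * sin \<theta> ^ 10)"]
  have "((\<lambda>r. - 4 * \<epsilon> ^ 3 * moment * integral {0..pi} (\<lambda>\<theta>. sin \<theta> * sin \<theta> ^ 10) * (r ^ 11 * (pw r 0) ^ 3))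
    \<longlongrightarrow> - 4 * \<epsilon> ^ 3 * moment * integral {0..pi} (\<lambda>\<theta>. sin \<theta> * sin \<theta> ^ 10)) at_top" by simp
  then show ?thesis
  proof (rule Lim_transform_eventually)
    show "\<forall>\<^sub>F r in at_top. - 4 * \<epsilon> ^ 3 * moment * integral {0..pi} (\<lambda>\<theta>. sin \<theta> * sin \<theta> ^ 10) * (r ^ 11 * (pw r 0) ^ 3)
        = r * sphere_int r cubic_flux"
      using eventually_gt_at_top[of 0]
      by eventually_elim (simp add: sphere_int_cubic_flux eval_nat_numeral mult_ac)
  qed
qed

lemma profile_mirror: "profile (refl mirror3 x) = profile x"
  and profile_antipode: "profile (refl antipode x) = profile x"
  by (simp_all add: profile_def quartic_def bracket_def power2_norm_eq_inner inner_vec_def sum_3 refl_def)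

lemma nonzero_angular_momentum:
  obtains l where "l \<noteq> 0" "has_ADM_angular_momentum g k (rotation_field 3) l"
proof -
  define l where "l = - 4 * \<epsilon> ^ 3 * moment * integral {0..pi} (\<lambda>\<theta>. sin \<theta> * sin \<theta> ^ 10) / (8 * pi)"
  have "l \<noteq> 0"
    using moment_pos sin_moment_pos eps_pos by (simp add: l_def)
  moreover have "has_ADM_angular_momentum g k (rotation_field 3) l"
  proof (rule angular_momentum_limit[OF sphere_int_angular_hessian])
    have "8 * pi * l = - 4 * \<epsilon> ^ 3 * moment * integral {0..pi} (\<lambda>\<theta>. sin \<theta> * sin \<theta> ^ 10)"
      by (simp add: l_def)
    then show "((\<lambda>r. r * sphere_int r cubic_flux) \<longlongrightarrow> 8 * pi * l) at_top"
      using flux_limit by (simp only:)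
  qed
  ultimately show ?thesis by (rule that)
qed

end

theorem theorem2:
  shows "\<exists>f :: real^3 \<Rightarrow> real.
     smooth f \<and> spacelike_graph f \<and>
     asymptotically_flat (induced_metric f) (second_form f) \<and>
     has_ADM_energy (induced_metric f) 0 \<and>
     (\<forall>i. has_ADM_momentum (induced_metric f) (second_form f) i 0) \<and>
     (\<exists>L :: real^3.
        (\<forall>i. has_ADM_angular_momentum (induced_metric f) (second_form f) (rotation_field i) (L $ i)) \<and>
        L \<noteq> 0)"
proof -
  obtain \<epsilon> where "\<epsilon> > 0"
    "\<And>x. (\<Sum>i\<in>UNIV. pd i (\<lambda>x. \<epsilon> * profile x) x * pd i (\<lambda>x. \<epsilon> * profile x) x) \<le> 1/2"
    using ex_scale by blast
  then interpret scaled_profile \<epsilon> by unfold_locales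
  let ?f = "\<lambda>x. \<epsilon> * profile x"
  obtain l where l: "l \<noteq> 0" "has_ADM_angular_momentum g k (rotation_field 3) l"
    by (rule nonzero_angular_momentum)
  \<comment> \<open>The first two components vanish by the mirror symmetry of the graph.\<close>
  define L :: "real^3" where "L = axis 3 l"
  have "has_ADM_angular_momentum g k (rotation_field i) (L $ i)" for i
    using angular_momentum_zero[of i] l by (cases "i = 3") (simp_all add: L_def axis_def profile_mirror)
  moreover have "L \<noteq> 0" using l by (simp add: L_def axis_eq_0_iff)
  ultimately show ?thesis
    using smooth_f spacelike flat energy_zero momentum_zero profile_antipode
    by (intro exI[of _ ?f]) auto
qed

end
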